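(* Let $\varphi:\mathbb{R}^n\to[0,1]$ be a Borel-measurable function that is almost invariant under $G(\mathfrak{M}_0)$. Suppose that $\varphi$ is neither $\lambda_{\mathbb{R}^n}$-almost everywhere equal to $1$ nor $\lambda_{\mathbb{R}^n}$-almost everywhere equal to $0$. Suppose further that $$\varphi(x+z)=\varphi(x)\quad\text{for every }x\in\mathbb{R}^n\text{ and every }z\in J(\mathfrak{C}).\qquad(\mathrm{a})$$ Assume that $\mathfrak{C}$ is bounded (as a subset of $\mathbb{R}^{n\times n}$). Assume also: (b) for every sequence $\Sigma_m\in\mathfrak{C}$ converging to a singular $\bar\Sigma$ there exist a subsequence $(m_i)_{i\in\mathbb{N}}$ and positive reals $s_{m_i}$ such that $D_{m_i}=\Pi_{\operatorname{span}(\bar\Sigma)^\perp}\Sigma_{m_i}\Pi_{\operatorname{span}(\bar\Sigma)^\perp}/s_{m_i}$ converges to a matrix $D$ which is regular on $\operatorname{span}(\bar\Sigma)^\perp$ (i.e. the linear map given by $D$ is injective when restricted to $\operatorname{span}(\bar\Sigma)^\perp$). Then: 1. The size of $\varphi$ is strictly less than $1$: $\sup_{\mu_0\in\mathfrak{M}_0}\sup_{0<\sigma^2<\infty}\sup_{\Sigma\in\mathfrak{C}}E_{\mu_0,\sigma^2\Sigma}(\varphi)<1$. Furthermore, $\inf_{\mu_0\in\mathfrak{M}_0}\inf_{0<\sigma^2<\infty}\inf_{\Sigma\in\mathfrak{C}}E_{\mu_0,\sigma^2\Sigma}(\varphi)>0$. 2. Suppose additionally that for every sequence $\nu_m\in\Pi_{(\mathfrak{M}_0-\mu_0)^\perp}(\mathfrak{M}_1-\mu_0)$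 with $\|\nu_m\|\to\infty$ and every sequence $\Phi_m$ of positive definite symmetric $n\times n$ matrices with $\Phi_m\to\Phi$, $\Phi$ positive definite, $$\liminf_{m\to\infty}E_{\nu_m+\mu_0,\Phi_m}(\varphi)>0,\qquad(\mathrm{c})$$ where $\mu_0$ is an element of $\mathfrak{M}_0$ (this condition does not depend on the choice of $\mu_0\in\mathfrak{M}_0$). Then $\inf_{\mu_1\in\mathfrak{M}_1}\inf_{0<\sigma^2<\infty}\inf_{\Sigma\in\mathfrak{C}}E_{\mu_1,\sigma^2\Sigma}(\varphi)>0$. 3. Suppose that the limit inferior in (c) equals $1$ for all sequences $\nu_m$ and $\Phi_m$ as specified in item 2. Then for every $0<c<\infty$ $$\inf_{\mu_1\in\mathfrak{M}_1,\ 0<\sigma^2<\infty,\ d(\mu_1,\mathfrak{M}_0)/\sigma\ge c}E_{\mu_1,\sigma^2\Sigma_m}(\varphi)\to1\quad(m\to\infty)$$ for any sequence $\Sigma_m\in\mathfrak{C}$ with $\Sigma_m\to\bar\Sigma$, $\bar\Sigma$ singular. Furthermore, for every sequence $0<c_m<\infty$ $$\inf_{\mu_1\in\mathfrak{M}_1,\ d(\mu_1,\mathfrak{M}_0)\ge c_m}E_{\mu_1,\sigma_m^2\Sigma_m}(\varphi)\to1\quad(m\to\infty)$$ whenever $0<\sigma_m^2<\infty$, $c_m/\sigma_m\to\infty$, and $\Sigma_m\in\mathfrak{C}$ satisfies $\Sigma_m\to\bar\Sigma$ with $\bar\Sigma$ positive definite. (This very last statement holds even without condition (a) and condition (b).)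
   Context: Framework: $n,k,q$ are integers with $1\le k<n$, $q\ge1$; $X$ is a fixed real $n\times k$ matrix of rank $k$; $R$ is a fixed real $q\times k$ matrix of rank $q$; $r\in\mathbb{R}^q$. $\mathfrak{C}$ (covariance model) is a nonempty set of symmetric positive definite $n\times n$ matrices such that $\sigma^2\in(0,\infty)$ and $\Sigma\in\mathfrak{C}$ are uniquely determined by $\sigma^2\Sigma$. $\mathfrak{M}=\operatorname{span}(X)$, $\mathfrak{M}_0=\{X\beta:\beta\in\mathbb{R}^k,\ R\beta=r\}$ (an affine space; $\mathfrak{M}_0-\mu_0$ is a linear space not depending on $\mu_0\in\mathfrak{M}_0$), $\mathfrak{M}_1=\mathfrak{M}\setminus\mathfrak{M}_0$. $E_{\mu,\Phi}$ is expectation under the Gaussian measure $P_{\mu,\Phi}$ on $\mathbb{R}^n$ with mean $\mu$ and covariance matrix $\Phi$. $\Pi_{\mathcal{L}}$ is the orthogonal projection onto the linear subspace $\mathcal{L}$; $d(x,A)$ is Euclidean distance; $\sigma,\sigma_m$ denote positive square roots. $J(\mathfrak{C})=\bigcup\{\operatorname{span}(\bar\Sigma):\det\bar\Sigma=0,\ \bar\Sigma=\lim_{m\to\infty}\Sigma_m\text{ for a sequence }\Sigma_m\in\mathfrak{C}\}$ (possibly empty; $\operatorname{span}$ denotes column space). $G(\mathfrak{M}_0)$ is the group of maps $y\mapsto\alpha(y-\mu_0)+\mu_0'$ with $\alpha\ne0$ real and $\mu_0,\mu_0'\in\mathfrak{M}_0$. A function $S$ on $\mathbb{R}^n$ is almost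 invariant under $G$ if for each $g\in G$ there is a Borel set $N(g)$ with $\lambda_{\mathbb{R}^n}(N(g))=0$ and $\lambda_{\mathbb{R}^n}(g'^{-1}(N(g)))=0$ for all $g'\in G$ such that $S(g(y))=S(y)$ for all $y\in\mathbb{R}^n\setminus N(g)$. $\lambda_{\mathbb{R}^n}$ is Lebesgue measure. *)

theory Defs
  imports "HOL-Analysis.Analysis"
begin

definition sym_pos_def :: "real^'n^'n \<Rightarrow> bool" where
  "sym_pos_def A \<longleftrightarrow> transpose A = A \<and> (\<forall>x. x \<noteq> 0 \<longrightarrow> 0 < x \<bullet> (A *v x))"

text \<open>The Gaussian measure with mean \<open>\<mu>\<close> and positive definite covariance matrix \<open>\<Phi>\<close>, given by its
  Lebesgue density; it is meaningful only if \<open>\<Phi>\<close> is symmetric positive definite.\<close>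

definition gaussian :: "real^'n \<Rightarrow> real^'n^'n \<Rightarrow> (real^'n) measure" where
  "gaussian \<mu> \<Phi> = density lborel (\<lambda>x. ennreal
     (exp (- ((x - \<mu>) \<bullet> (matrix_inv \<Phi> *v (x - \<mu>))) / 2)
        / ((2 * pi) powr (real CARD('n) / 2) * sqrt (det \<Phi>))))"

definition gaussian_expectation :: "real^'n \<Rightarrow> real^'n^'n \<Rightarrow> (real^'n \<Rightarrow> real) \<Rightarrow> real" where
  "gaussian_expectation \<mu> \<Phi> f = (\<integral>x. f x \<partial>gaussian \<mu> \<Phi>)"

definition orth_proj :: "'a::euclidean_space set \<Rightarrow> 'a \<Rightarrow> 'a" where
  "orth_proj L x = (THE p. p \<in> L \<and> x - p \<in> orthogonal_comp L)"

lemma orth_proj_unique_exists: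
  fixes L :: "'a::euclidean_space set"
  assumes "subspace L"
  shows "\<exists>!p. p \<in> L \<and> x - p \<in> orthogonal_comp L"
proof (rule ex_ex1I)
  obtain y z where "y \<in> L" "\<And>w. w \<in> L \<Longrightarrow> orthogonal z w" "x = y + z"
    using orthogonal_subspace_decomp_exists[of L x] assms by (metis span_eq_iff)
  then show "\<exists>p. p \<in> L \<and> x - p \<in> orthogonal_comp L"
    by (intro exI[of _ y])
      (auto simp: orthogonal_comp_def orthogonal_commute)
next
  fix p p' assume p: "p \<in> L \<and> x - p \<in> orthogonal_comp L" "p' \<in> L \<and> x - p' \<in> orthogonal_comp L"
  then have "(x - p') - (x - p) \<in> orthogonal_comp L"
    using subspace_diff subspace_orthogonal_comp by blast
  moreover have "p - p' \<in> L" using p assms subspace_diff by blast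
  ultimately show "p = p'" by (auto simp: orthogonal_comp_def orthogonal_def)
qed

definition orth_proj_matrix :: "(real^'n) set \<Rightarrow> real^'n^'n" where
  "orth_proj_matrix L = matrix (orth_proj L)"

definition covariance_model :: "(real^'n^'n) set \<Rightarrow> bool" where
  "covariance_model C \<longleftrightarrow> C \<noteq> {} \<and> (\<forall>S\<in>C. sym_pos_def S) \<and>
     (\<forall>a b. \<forall>S\<in>C. \<forall>T\<in>C. 0 < a \<longrightarrow> 0 < b \<longrightarrow> a *\<^sub>R S = b *\<^sub>R T \<longrightarrow> a = b \<and> S = T)"

definition null_means :: "real^'k^'n \<Rightarrow> real^'k^'q \<Rightarrow> real^'q \<Rightarrow> (real^'n) set" where
  "null_means X R r = {X *v \<beta> | \<beta>. R *v \<beta> = r}"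

definition alt_means :: "real^'k^'n \<Rightarrow> real^'k^'q \<Rightarrow> real^'q \<Rightarrow> (real^'n) set" where
  "alt_means X R r = span (columns X) - null_means X R r"

definition concentration_set :: "(real^'n^'n) set \<Rightarrow> (real^'n) set" where
  "concentration_set C =
     \<Union> {span (columns T) | T. det T = 0 \<and> (\<exists>S. (\<forall>m. S m \<in> C) \<and> S \<longlonglongrightarrow> T)}"

definition invariance_group :: "(real^'n) set \<Rightarrow> (real^'n \<Rightarrow> real^'n) set" where
  "invariance_group M0 =
     {\<lambda>y. \<alpha> *\<^sub>R (y - \<mu>) + \<mu>' | \<alpha> \<mu> \<mu>'. \<alpha> \<noteq> 0 \<and> \<mu> \<in> M0 \<and> \<mu>' \<in> M0}"

definition almost_invariant :: "(real^'n \<Rightarrow> real^'n) set \<Rightarrow> (real^'n \<Rightarrow> 'b) \<Rightarrow> bool" where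
  "almost_invariant G f \<longleftrightarrow>
     (\<forall>g\<in>G. \<exists>N\<in>sets borel. emeasure lborel N = 0 \<and>
        (\<forall>g'\<in>G. emeasure lborel (g' -` N) = 0) \<and> (\<forall>y. y \<notin> N \<longrightarrow> f (g y) = f y))"

text \<open>Along every sequence of the model with singular limit \<open>T\<close>, the part of the covariance matrix
  orthogonal to the column space of \<open>T\<close> can, after rescaling and passing to a subsequence, be made to
  converge to a matrix that is injective on that orthogonal complement.\<close>

definition regular_rescaling :: "(real^'n^'n) set \<Rightarrow> bool" where
  "regular_rescaling C \<longleftrightarrow>
     (\<forall>S T. (\<forall>m. S m \<in> C) \<and> S \<longlonglongrightarrow> T \<and> det T = 0 \<longrightarrow>
        (let L = orthogonal_comp (span (columns T)); P = orth_proj_matrix L in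
         \<exists>h s D. strict_mono (h :: nat \<Rightarrow> nat) \<and> (\<forall>i. (0::real) < s (h i)) \<and>
           (\<lambda>i. (1 / s (h i)) *\<^sub>R (P ** S (h i) ** P)) \<longlonglongrightarrow> D \<and>
           inj_on (\<lambda>x. D *v x) L))"

text \<open>The pairs of sequences \<open>\<nu>\<^sub>m \<in> \<Pi>((\<MM>\<^sub>0 - \<mu>\<^sub>0)\<^sup>\<bottom>) (\<MM>\<^sub>1 - \<mu>\<^sub>0)\<close> and \<open>\<Phi>\<^sub>m\<close> over which the
  limit-inferior condition ranges, for a given base point \<open>\<mu>\<^sub>0\<close> of \<open>M0\<close>.\<close>

definition diverging_means ::
  "(real^'n) set \<Rightarrow> (real^'n) set \<Rightarrow> real^'n \<Rightarrow> (nat \<Rightarrow> real^'n) \<Rightarrow> (nat \<Rightarrow> real^'n^'n) \<Rightarrow> bool" where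
  "diverging_means M0 M1 \<mu>\<^sub>0 \<nu> \<Phi> \<longleftrightarrow>
     (\<forall>m. \<nu> m \<in> orth_proj (orthogonal_comp ((\<lambda>x. x - \<mu>\<^sub>0) ` M0)) ` ((\<lambda>x. x - \<mu>\<^sub>0) ` M1)) \<and>
     filterlim (\<lambda>m. norm (\<nu> m)) at_top sequentially \<and>
     (\<forall>m. sym_pos_def (\<Phi> m)) \<and> (\<exists>\<Psi>. sym_pos_def \<Psi> \<and> \<Phi> \<longlonglongrightarrow> \<Psi>)"

definition liminf_positive ::
  "(real^'n) set \<Rightarrow> (real^'n) set \<Rightarrow> (real^'n \<Rightarrow> real) \<Rightarrow> real^'n \<Rightarrow> bool" where
  "liminf_positive M0 M1 \<phi> \<mu>\<^sub>0 \<longleftrightarrow> (\<forall>\<nu> \<Phi>. diverging_means M0 M1 \<mu>\<^sub>0 \<nu> \<Phi> \<longrightarrow>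
     0 < liminf (\<lambda>m. ereal (gaussian_expectation (\<nu> m + \<mu>\<^sub>0) (\<Phi> m) \<phi>)))"

definition liminf_one ::
  "(real^'n) set \<Rightarrow> (real^'n) set \<Rightarrow> (real^'n \<Rightarrow> real) \<Rightarrow> real^'n \<Rightarrow> bool" where
  "liminf_one M0 M1 \<phi> \<mu>\<^sub>0 \<longleftrightarrow> (\<forall>\<nu> \<Phi>. diverging_means M0 M1 \<mu>\<^sub>0 \<nu> \<Phi> \<longrightarrow>
     liminf (\<lambda>m. ereal (gaussian_expectation (\<nu> m + \<mu>\<^sub>0) (\<Phi> m) \<phi>)) = 1)"

end

theory Submission
  imports Defs "HOL-Probability.Distributions"
begin

text \<open>
  Write \<open>E(\<mu>, \<Phi>)\<close> for the Gaussian expectation of the test.  It is continuous in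
  \<open>(\<mu>, \<Phi>)\<close> at positive definite \<open>\<Phi>\<close> (\<open>gaussian_expectation_tendsto\<close>), and it lies
  strictly between zero and one there, since the test is neither almost everywhere zero nor almost
  everywhere one.  The bounds on size and power would follow by compactness if the parameters ranged
  over a compact set on which all covariance matrices are positive definite.  Two reductions replace
  this.

  The first one concerns the mean and the scale.  By almost invariance,
  \<open>E(\<mu>, w \<Phi>) = E(\<mu>0 + \<nu> / \<surd>w, \<Phi>)\<close>, where \<open>\<nu>\<close> is the component of \<open>\<mu> - \<mu>0\<close>
  orthogonal to the direction space of the null hypothesis and has the distance of \<open>\<mu>\<close> to the null
  hypothesis as its norm (\<open>expectation_reduction\<close>).  Null means thus collapse to a single point.
  For alternatives only the vector \<open>\<nu> / \<surd>w\<close> remains, which along a sequence either has a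
  convergent subsequence, so that continuity applies, or diverges in norm, so that the assumption on
  the limit inferior applies.

  The second one concerns degenerating covariance matrices.  Let \<open>\<Sigma>\<close> run through a sequence
  with singular limit \<open>T\<close>, let \<open>W\<close> be the column space of \<open>T\<close>, and let \<open>P\<close> be the
  projection onto its orthogonal complement.  The test is constant along \<open>W\<close>, so only the block
  \<open>P \<Sigma> P\<close> matters, and \<open>E(\<mu>, \<Sigma>) = E(\<mu>, P \<Sigma> P + s (I - P))\<close> for every \<open>s > 0\<close>
  (\<open>gaussian_expectation_mod_subspace\<close>).  With \<open>s\<close> the rescaling factor of the model, division
  by \<open>s\<close> makes these matrices converge to \<open>D + I - P\<close>, which is positive definite.  Hence,
  along a subsequence, every sequence in the model can be exchanged for a convergent one with
  positive definite limit at the price of a factor \<open>s\<close> in the variance (\<open>model_subsequence\<close>).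
  Since \<open>P T P = 0\<close> while \<open>D\<close> is nonzero, this factor tends to zero for singular limits; this is
  why the power tends to one there although the distance relative to the scale is merely bounded
  below.

  All of this rests on the description of the Gaussian measure with covariance \<open>F F\<^sup>T\<close> as the
  image of the standard one under \<open>x \<mapsto> \<mu> + F x\<close> (\<open>gaussian_eq_distr\<close>).  The measure being
  given by a density, this is a linear change of variables in Lebesgue measure, which is derived here
  from the singular value decomposition and the rotation invariance of Lebesgue measure.
\<close>

section \<open>Symmetric matrices and factorizations\<close>

lemma inner_matrix_vector_transpose:
  fixes A :: "real^'n^'m"
  shows "x \<bullet> (A *v y) = (transpose A *v x) \<bullet> y"
  by (simp add: dot_lmul_matrix)

lemma symmetric_form_commute:
  fixes A :: "real^'n^'n"
  assumes "transpose A = A"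
  shows "x \<bullet> (A *v y) = y \<bullet> (A *v x)"
  by (metis assms inner_matrix_vector_transpose inner_commute)

text \<open>The form is non-negative at \<open>v + t w\<close> for every real \<open>t\<close>; as its constant term
  in \<open>t\<close> vanishes, so must its linear coefficient.  It is applied on a subspace to
  construct eigenvectors, and on the whole space to limits of covariance matrices.\<close>

lemma psd_form_null_vector:
  fixes A :: "real^'n^'n"
  assumes sym: "transpose A = A" and L: "subspace L"
    and nonneg: "\<And>x. x \<in> L \<Longrightarrow> 0 \<le> x \<bullet> (A *v x)"
    and v: "v \<in> L" "v \<bullet> (A *v v) = 0" and w: "w \<in> L"
  shows "w \<bullet> (A *v v) = 0"
proof -
  define b c where "b = w \<bullet> (A *v v)" and "c = w \<bullet> (A *v w)"
  have c: "0 \<le> c" using nonneg w by (simp add: c_def)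
  \<comment> \<open>Not the minimizer \<open>- b / c\<close>, which does not exist for \<open>c = 0\<close>.\<close>
  define t where "t = - b / (c + 1)"
  have "0 \<le> (v + t *\<^sub>R w) \<bullet> (A *v (v + t *\<^sub>R w))"
    using L v w by (intro nonneg) (auto intro: subspace_add subspace_scale)
  also have "\<dots> = 2 * t * b + t\<^sup>2 * c"
    using v symmetric_form_commute[OF sym, of v w]
    by (simp add: b_def c_def matrix_vector_right_distrib matrix_vector_mult_scaleR
        inner_add_left inner_add_right power2_eq_square distrib_left)
  also have "\<dots> = - (b\<^sup>2 * (c + 2) / (c + 1)\<^sup>2)"
    using c by (simp add: t_def power2_eq_square divide_simps) (simp add: algebra_simps)
  finally have "b\<^sup>2 * (c + 2) / (c + 1)\<^sup>2 \<le> 0" by simp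
  then have "b\<^sup>2 * (c + 2) \<le> 0" using c by (simp add: divide_le_0_iff)
  then have "b\<^sup>2 \<le> 0" using c by (simp add: mult_le_0_iff)
  then show ?thesis by (simp add: b_def)
qed

definition diag_matrix :: "('n \<Rightarrow> real) \<Rightarrow> real^'n^'n" where
  "diag_matrix d = (\<chi> i j. if i = j then d i else 0)"

lemma diag_matrix_vector: "diag_matrix d *v x = (\<chi> i. d i * x $ i)"
  by (simp add: diag_matrix_def matrix_vector_mult_def vec_eq_iff if_distrib[of "\<lambda>a. a * _"] cong: if_cong)

lemma diag_matrix_mult: "diag_matrix a ** diag_matrix b = diag_matrix (\<lambda>i. a i * b i)"
  unfolding matrix_eq by (simp add: matrix_vector_mul_assoc[symmetric] diag_matrix_vector mult.assoc)

lemma transpose_diag_matrix [simp]: "transpose (diag_matrix d) = diag_matrix d"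
  by (simp add: diag_matrix_def transpose_def vec_eq_iff)

lemma diag_matrix_one: "diag_matrix (\<lambda>i. 1) = mat 1"
  by (simp add: diag_matrix_def mat_def)

lemma det_diag_matrix: "det (diag_matrix d) = (\<Prod>i\<in>UNIV. d i)"
  by (subst det_diagonal) (auto simp: diag_matrix_def)

text \<open>The next eigenvector maximizes the quadratic form over the unit sphere of the orthogonal
  complement \<open>L\<close> of the previous ones.  With \<open>l\<close> the maximum, \<open>l I - A\<close> is
  non-negative on \<open>L\<close> and null at the maximizer, so the preceding lemma applies; \<open>L\<close> is
  mapped to itself by \<open>A\<close>, which turns nullity of the form into nullity of the vector.\<close>

lemma symmetric_orthonormal_eigenvectors:
  fixes A :: "real^'n^'n"
  assumes sym: "transpose A = A"
  shows "k \<le> CARD('n) \<Longrightarrow> \<exists>f d. \<forall>i<k. A *v f i = d i *\<^sub>R f i \<and>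
           (\<forall>j<k. f i \<bullet> f j = (if i = j then 1 else (0::real)))"
proof (induction k)
  case 0
  show ?case by simp
next
  case (Suc k)
  then obtain f d where f: "\<And>i. i < k \<Longrightarrow> A *v f i = d i *\<^sub>R f i"
    "\<And>i j. i < k \<Longrightarrow> j < k \<Longrightarrow> f i \<bullet> f j = (if i = j then 1 else 0)"
    by auto
  define L where "L = {x::real^'n. \<forall>i<k. f i \<bullet> x = 0}"
  have L: "subspace L"
    by (auto simp: L_def subspace_def inner_add_right)
  have "dim (f ` {..<k}) \<le> card (f ` {..<k})"
    by (intro dim_le_card span_superset finite_imageI finite_lessThan)
  also have "\<dots> \<le> k" using card_image_le[of "{..<k}" f] by simp
  finally have "dim (f ` {..<k}) \<le> k" .
  then have "dim (f ` {..<k}) < DIM(real^'n)" using Suc.prems by simp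
  then obtain x0 where x0: "x0 \<noteq> 0" "\<And>y. y \<in> span (f ` {..<k}) \<Longrightarrow> orthogonal x0 y"
    using orthogonal_to_subspace_exists by blast
  have "x0 \<in> L"
    using x0(2) by (auto simp: L_def orthogonal_def inner_commute[of "f _"] intro: span_base)
  define K where "K = L \<inter> sphere 0 1"
  have "compact K"
    unfolding K_def using L by (simp add: closed_Int_compact closed_subspace)
  moreover have "(1 / norm x0) *\<^sub>R x0 \<in> K"
    using x0(1) \<open>x0 \<in> L\<close> L by (simp add: K_def subspace_scale)
  moreover have "continuous_on K (\<lambda>x. x \<bullet> (A *v x))"
    by (intro continuous_intros)
  ultimately obtain v where v: "v \<in> K" "\<And>y. y \<in> K \<Longrightarrow> y \<bullet> (A *v y) \<le> v \<bullet> (A *v v)"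
    using continuous_attains_sup[of K "\<lambda>x. x \<bullet> (A *v x)"] by blast
  define l where "l = v \<bullet> (A *v v)"
  define B where "B = l *\<^sub>R mat 1 - A"
  have Bx: "B *v x = l *\<^sub>R x - A *v x" for x
    by (simp add: B_def matrix_vector_mult_diff_rdistrib scaleR_matrix_vector_assoc[symmetric])
  have vL: "v \<in> L" "norm v = 1" "v \<bullet> v = 1" using v by (auto simp: K_def dot_square_norm)
  have symB: "transpose B = B"
    using sym by (simp add: B_def transpose_def vec_eq_iff mat_def)
  have nonneg: "0 \<le> x \<bullet> (B *v x)" if "x \<in> L" for x
  proof (cases "x = 0")
    case False
    define y where "y = (1 / norm x) *\<^sub>R x"
    have "y \<in> K" using that False L by (simp add: K_def y_def subspace_scale)
    then have "y \<bullet> (A *v y) \<le> l" using v l_def by blast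
    moreover have "y \<bullet> (A *v y) = (x \<bullet> (A *v x)) / (x \<bullet> x)"
      by (simp add: y_def matrix_vector_mult_scaleR dot_square_norm power2_eq_square)
    ultimately have "x \<bullet> (A *v x) \<le> l * (x \<bullet> x)"
      using False by (simp add: divide_le_eq)
    then show ?thesis by (simp add: Bx inner_diff_right)
  qed simp
  have v0: "v \<bullet> (B *v v) = 0" by (simp add: Bx inner_diff_right vL l_def)
  have "B *v v \<in> L"
  proof -
    have "f i \<bullet> (B *v v) = 0" if "i < k" for i
    proof -
      have "f i \<bullet> (A *v v) = v \<bullet> (A *v f i)" by (rule symmetric_form_commute[OF sym])
      also have "\<dots> = 0" using vL(1) that f(1) by (simp add: L_def inner_commute)
      finally show ?thesis using vL(1) that by (simp add: Bx inner_diff_right L_def)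
    qed
    then show ?thesis by (simp add: L_def)
  qed
  then have "(B *v v) \<bullet> (B *v v) = 0"
    by (intro psd_form_null_vector[OF symB L nonneg vL(1) v0])
  then have Av: "A *v v = l *\<^sub>R v" by (simp add: Bx)
  have fv: "f i \<bullet> v = 0" "v \<bullet> f i = 0" if "i < k" for i
    using vL(1) that by (auto simp: L_def inner_commute)
  have "\<forall>i<Suc k. A *v (f(k := v)) i = (d(k := l)) i *\<^sub>R (f(k := v)) i \<and>
           (\<forall>j<Suc k. (f(k := v)) i \<bullet> (f(k := v)) j = (if i = j then 1 else 0))"
    using f Av vL(3) fv by (auto simp: less_Suc_eq)
  then show ?case by blast
qed

lemma symmetric_matrix_diagonalization:
  fixes A :: "real^'n^'n"
  assumes sym: "transpose A = A"
  obtains Q d where "orthogonal_matrix Q" "A = Q ** diag_matrix d ** transpose Q"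
proof -
  obtain f d where f: "\<And>i. i < CARD('n) \<Longrightarrow> A *v f i = d i *\<^sub>R f i"
    "\<And>i j. i < CARD('n) \<Longrightarrow> j < CARD('n) \<Longrightarrow> f i \<bullet> f j = (if i = j then 1 else 0)"
    using symmetric_orthonormal_eigenvectors[OF sym, of "CARD('n)"] by auto
  obtain h where h: "bij_betw h (UNIV::'n set) {0..<CARD('n)}"
    using ex_bij_betw_finite_nat[of "UNIV::'n set"] by auto
  have hlt: "h i < CARD('n)" for i using h bij_betwE by fastforce
  have hinj: "h i = h j \<longleftrightarrow> i = j" for i j
    using h by (auto simp: bij_betw_def inj_on_def)
  define Q :: "real^'n^'n" where "Q = (\<chi> i j. f (h j) $ i)"
  have col: "column j Q = f (h j)" for j by (simp add: column_def Q_def)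
  have oq: "orthogonal_matrix Q"
    by (simp add: orthogonal_matrix matrix_mult_transpose_dot_column col f(2) hlt hinj mat_def)
  have "A ** Q = Q ** diag_matrix (d \<circ> h)"
  proof -
    have "(A ** Q) $ i $ j = (Q ** diag_matrix (d \<circ> h)) $ i $ j" for i j
    proof -
      have "(A ** Q) $ i $ j = (A *v f (h j)) $ i"
        by (simp add: matrix_matrix_mult_def matrix_vector_mult_def Q_def)
      also have "\<dots> = d (h j) * f (h j) $ i" by (simp add: f(1) hlt)
      also have "\<dots> = (Q ** diag_matrix (d \<circ> h)) $ i $ j"
        by (simp add: matrix_matrix_mult_def diag_matrix_def Q_def if_distrib cong: if_cong)
      finally show ?thesis .
    qed
    then show ?thesis by (simp add: vec_eq_iff)
  qed
  then have "A ** (Q ** transpose Q) = Q ** diag_matrix (d \<circ> h) ** transpose Q"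
    by (simp add: matrix_mul_assoc)
  then show thesis using oq by (intro that[OF oq]) (simp add: orthogonal_matrix_def)
qed

lemma orthogonal_matrix_invertible:
  fixes Q :: "real^'n^'n"
  shows "orthogonal_matrix Q \<Longrightarrow> invertible Q"
  by (auto simp: orthogonal_matrix_def invertible_def)

text \<open>Positive eigenvalues are written as squares: the square roots \<open>s\<close> are the singular values
  of every \<open>F\<close> with \<open>F F\<^sup>T = A\<close>.\<close>

lemma sym_pos_def_factor:
  fixes A :: "real^'n^'n"
  assumes A: "sym_pos_def A"
  obtains Q s where "orthogonal_matrix Q" "\<And>i. 0 < s i"
    "A = Q ** diag_matrix (\<lambda>i. s i * s i) ** transpose Q"
proof -
  obtain Q d where Q: "orthogonal_matrix Q" "A = Q ** diag_matrix d ** transpose Q"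
    using symmetric_matrix_diagonalization A by (metis sym_pos_def_def)
  have "0 < d i" for i
  proof -
    let ?q = "Q *v axis i 1"
    have QQ: "transpose Q *v ?q = axis i 1"
      using Q(1) by (simp add: orthogonal_matrix_def matrix_vector_mul_assoc del: transpose_matrix_vector)
    then have "?q \<noteq> 0" by (metis axis_eq_0_iff matrix_vector_mult_0_right zero_neq_one)
    then have "0 < ?q \<bullet> (A *v ?q)" using A by (simp add: sym_pos_def_def)
    also have "A *v ?q = Q *v (diag_matrix d *v axis i 1)"
      unfolding Q(2) using QQ
      by (simp add: matrix_vector_mul_assoc[symmetric] del: transpose_matrix_vector)
    also have "?q \<bullet> \<dots> = axis i 1 \<bullet> (diag_matrix d *v axis i 1)"
      using QQ by (simp add: inner_matrix_vector_transpose[of _ Q] del: transpose_matrix_vector)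
    also have "\<dots> = d i" by (simp add: diag_matrix_vector inner_axis')
    finally show ?thesis .
  qed
  then have "d = (\<lambda>i. sqrt (d i) * sqrt (d i))" by (auto simp: less_imp_le)
  then show thesis using that[of Q "\<lambda>i. sqrt (d i)"] Q \<open>\<And>i. 0 < d i\<close> by auto
qed

lemma sym_pos_def_mult_transpose:
  fixes F :: "real^'n^'n"
  assumes "invertible F"
  shows "sym_pos_def (F ** transpose F)"
proof -
  have "0 < x \<bullet> ((F ** transpose F) *v x)" if "x \<noteq> 0" for x
  proof -
    have "transpose F *v x \<noteq> 0"
      using assms that by (metis inj_matrix_vector_mult injD matrix_vector_mult_0_right transpose_invertible)
    then have "0 < (transpose F *v x) \<bullet> (transpose F *v x)" by (simp del: transpose_matrix_vector)
    then show ?thesis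
      by (metis inner_matrix_vector_transpose matrix_vector_mul_assoc)
  qed
  then show ?thesis by (simp add: sym_pos_def_def matrix_transpose_mul)
qed

lemma invertible_diag_matrix:
  assumes "\<And>i. s i \<noteq> (0::real)"
  shows "invertible (diag_matrix s)"
  using assms by (simp add: invertible_det_nz det_diag_matrix)

lemma sym_pos_def_square_root:
  fixes A :: "real^'n^'n"
  assumes "sym_pos_def A"
  obtains F :: "real^'n^'n" where "invertible F" "A = F ** transpose F"
proof -
  obtain Q s where Q: "orthogonal_matrix Q" "\<And>i. 0 < s i"
    "A = Q ** diag_matrix (\<lambda>i. s i * s i) ** transpose Q"
    using sym_pos_def_factor[OF assms] by blast
  have "invertible (Q ** diag_matrix s)"
    using Q by (intro invertible_mult orthogonal_matrix_invertible invertible_diag_matrix)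
      (auto simp: less_imp_neq[symmetric])
  moreover have "A = (Q ** diag_matrix s) ** transpose (Q ** diag_matrix s)"
    using Q(3) by (simp add: matrix_transpose_mul diag_matrix_mult[symmetric] matrix_mul_assoc)
  ultimately show thesis using that by blast
qed

lemma sym_pos_def_invertible: "sym_pos_def A \<Longrightarrow> invertible A"
  by (metis invertible_mult sym_pos_def_square_root transpose_invertible)

text \<open>Diagonalize \<open>F F\<^sup>T = P S\<^sup>2 P\<^sup>T\<close>; then \<open>Q = inverse S P\<^sup>T F\<close> is orthogonal.\<close>

lemma singular_value_decomposition:
  fixes F :: "real^'n^'n"
  assumes F: "invertible F"
  obtains P s Q where "orthogonal_matrix P" "\<And>i. 0 < s i" "orthogonal_matrix Q"
    "F = P ** diag_matrix s ** Q"
proof -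
  obtain P s where P: "orthogonal_matrix P" "\<And>i. 0 < s i"
    "F ** transpose F = P ** diag_matrix (\<lambda>i. s i * s i) ** transpose P"
    using sym_pos_def_factor[OF sym_pos_def_mult_transpose[OF F]] by blast
  define T where "T = diag_matrix (\<lambda>i. 1 / s i)"
  have sn: "s i \<noteq> 0" for i using P(2)[of i] by simp
  have T: "diag_matrix s ** T = mat 1" "T ** diag_matrix s = mat 1"
    by (simp_all add: T_def diag_matrix_mult sn diag_matrix_one)
  define Q where "Q = T ** transpose P ** F"
  have PP: "transpose P ** P = mat 1" "P ** transpose P = mat 1"
    using P(1) by (auto simp: orthogonal_matrix_def)
  have "Q ** transpose Q = T ** transpose P ** (F ** transpose F) ** P ** T"
    by (simp add: Q_def matrix_transpose_mul matrix_mul_assoc T_def)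
  also have "\<dots> = T ** (transpose P ** P) ** (diag_matrix s ** diag_matrix s) ** (transpose P ** P) ** T"
    unfolding P(3) by (simp add: diag_matrix_mult matrix_mul_assoc)
  also have "\<dots> = (T ** diag_matrix s) ** (diag_matrix s ** T)"
    unfolding PP by (simp add: matrix_mul_assoc)
  finally have "Q ** transpose Q = mat 1" by (simp add: T)
  then have "orthogonal_matrix Q"
    using matrix_left_right_inverse[of Q "transpose Q"] by (simp add: orthogonal_matrix_def)
  moreover have "F = P ** (diag_matrix s ** T) ** transpose P ** F"
    by (simp add: T PP)
  then have "F = P ** diag_matrix s ** Q"
    by (simp add: Q_def matrix_mul_assoc)
  ultimately show thesis using that P by blast
qed

lemma matrix_inv_unique:
  fixes A B :: "real^'n^'n"
  assumes "A ** B = mat 1"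
  shows "matrix_inv A = B"
proof -
  have B: "A ** B = mat 1 \<and> B ** A = mat 1" using assms matrix_left_right_inverse by blast
  then have "A ** matrix_inv A = mat 1 \<and> matrix_inv A ** A = mat 1"
    unfolding matrix_inv_def by (rule someI)
  then have "B ** (A ** matrix_inv A) = B" by simp
  then show ?thesis using B by (simp add: matrix_mul_assoc)
qed

lemma matrix_inv_works:
  fixes A :: "real^'n^'n"
  assumes "invertible A"
  shows "A ** matrix_inv A = mat 1" "matrix_inv A ** A = mat 1"
proof -
  obtain B where B: "A ** B = mat 1" "B ** A = mat 1" using assms by (auto simp: invertible_def)
  then have "matrix_inv A = B" using matrix_inv_unique by blast
  then show "A ** matrix_inv A = mat 1" "matrix_inv A ** A = mat 1" using B by auto
qed

lemma sym_pos_def_scaleR: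
  "0 < c \<Longrightarrow> sym_pos_def A \<Longrightarrow> sym_pos_def (c *\<^sub>R A)"
  by (auto simp: sym_pos_def_def transpose_scalar scaleR_matrix_vector_assoc[symmetric])

lemma det_sym_pos_def:
  fixes A :: "real^'n^'n"
  assumes "sym_pos_def A"
  shows "0 < det A"
proof -
  obtain F :: "real^'n^'n" where F: "invertible F" "A = F ** transpose F"
    using sym_pos_def_square_root[OF assms] by blast
  then have "det F \<noteq> 0" by (simp add: invertible_det_nz)
  then have "0 < det F * det F" using not_real_square_gt_zero by blast
  then show ?thesis by (simp add: F(2) det_mul)
qed

lemma matrix_inv_vector:
  fixes A :: "real^'n^'n"
  assumes "sym_pos_def A"
  shows "A *v (matrix_inv A *v x) = x"
  using matrix_inv_works(1)[OF sym_pos_def_invertible[OF assms]]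
  by (simp add: matrix_vector_mul_assoc)

lemma orthogonal_matrix_norm:
  fixes Q :: "real^'n^'n"
  assumes "orthogonal_matrix Q"
  shows "norm (Q *v x) = norm x"
proof -
  have "(Q *v x) \<bullet> (Q *v x) = (transpose Q *v (Q *v x)) \<bullet> x"
    by (rule inner_matrix_vector_transpose)
  also have "transpose Q *v (Q *v x) = x"
    using assms by (simp add: orthogonal_matrix_def matrix_vector_mul_assoc del: transpose_matrix_vector)
  finally show ?thesis by (simp add: norm_eq_sqrt_inner)
qed

section \<open>The standard Gaussian density\<close>

lemma measurable_matrix_vector [measurable]:
  fixes A :: "real^'n^'m"
  shows "(\<lambda>x. A *v x) \<in> borel_measurable borel"
  by (intro borel_measurable_continuous_onI continuous_intros)

text \<open>The scale \<open>s\<close> is kept general because the same integral, with \<open>s\<close> adapted to the covariance matrices, supplies the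
  integrable majorant in the continuity proof below.\<close>

lemma nn_integral_gaussian_product:
  assumes s: "0 < (s::real)"
  shows "(\<integral>\<^sup>+x. ennreal (exp (- (x \<bullet> x) / (2 * s\<^sup>2)) / sqrt (2 * pi * s\<^sup>2) ^ CARD('n)) \<partial>(lborel::(real^'n) measure)) = 1"
proof -
  have "(\<integral>\<^sup>+x. (\<Prod>b\<in>Basis. ennreal (normal_density 0 s (x \<bullet> b))) \<partial>(lborel::(real^'n) measure))
      = (\<Prod>b\<in>(Basis::(real^'n) set). (\<integral>\<^sup>+x. ennreal (normal_density 0 s x) \<partial>lborel))"
    by (subst nn_integral_lborel_prod) auto
  also have "(\<integral>\<^sup>+x. ennreal (normal_density 0 s x) \<partial>lborel) = 1"
    using s by (simp add: nn_integral_eq_integral)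
  also have "(\<Prod>b\<in>(Basis::(real^'n) set). 1) = (1::ennreal)" by simp
  finally have one: "(\<integral>\<^sup>+x. (\<Prod>b\<in>Basis. ennreal (normal_density 0 s (x \<bullet> b))) \<partial>(lborel::(real^'n) measure)) = 1" .
  have "(\<Prod>b\<in>Basis. ennreal (normal_density 0 s (x \<bullet> b))) =
      ennreal (exp (- (x \<bullet> x) / (2 * s\<^sup>2)) / sqrt (2 * pi * s\<^sup>2) ^ CARD('n))" for x :: "real^'n"
  proof -
    have "(\<Prod>b\<in>Basis. ennreal (normal_density 0 s (x \<bullet> b))) = ennreal (\<Prod>b\<in>Basis. normal_density 0 s (x \<bullet> b))"
      by (simp add: prod_ennreal)
    also have "(\<Prod>b\<in>Basis. normal_density 0 s (x \<bullet> b)) =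
        (1 / sqrt (2 * pi * s\<^sup>2)) ^ CARD('n) * exp (\<Sum>b\<in>Basis. - (x \<bullet> b)\<^sup>2 / (2 * s\<^sup>2))"
      by (simp add: normal_density_def prod.distrib exp_sum prod_dividef power_divide)
    also have "(\<Sum>b\<in>Basis. - (x \<bullet> b)\<^sup>2 / (2 * s\<^sup>2)) = - (x \<bullet> x) / (2 * s\<^sup>2)"
      by (subst euclidean_inner[of x x]) (simp add: sum_divide_distrib sum_negf power2_eq_square)
    finally show ?thesis by (simp add: power_divide)
  qed
  then show ?thesis using one by simp
qed

definition gaussian_density :: "real^'n \<Rightarrow> real^'n^'n \<Rightarrow> real^'n \<Rightarrow> real" where
  "gaussian_density \<mu> \<Phi> x = exp (- ((x - \<mu>) \<bullet> (matrix_inv \<Phi> *v (x - \<mu>))) / 2)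
        / ((2 * pi) powr (real CARD('n) / 2) * sqrt (det \<Phi>))"

lemma gaussian_eq_density: "gaussian \<mu> \<Phi> = density lborel (\<lambda>x. ennreal (gaussian_density \<mu> \<Phi> x))"
  by (simp add: gaussian_def gaussian_density_def)

lemma measurable_gaussian_density [measurable]:
  "gaussian_density \<mu> \<Phi> \<in> borel_measurable borel"
  unfolding gaussian_density_def by measurable

lemma sets_gaussian [simp, measurable_cong]: "sets (gaussian \<mu> \<Phi>) = sets borel"
  by (simp add: gaussian_def)

lemma space_gaussian [simp]: "space (gaussian \<mu> \<Phi>) = UNIV"
  by (simp add: gaussian_def)

lemma standard_gaussian_density:
  "gaussian_density 0 (mat 1) (x::real^'n) = exp (- (x \<bullet> x) / 2) / (2 * pi) powr (real CARD('n) / 2)"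
  by (simp add: gaussian_density_def matrix_inv_unique[of "mat 1" "mat 1"])

lemma nn_integral_standard_gaussian_density:
  "(\<integral>\<^sup>+x. ennreal (gaussian_density 0 (mat 1) x) \<partial>(lborel::(real^'n) measure)) = 1"
proof -
  have "(2 * pi) powr (real CARD('n) / 2) = sqrt (2 * pi) ^ CARD('n)"
    by (simp add: powr_half_sqrt[symmetric] powr_realpow[symmetric] powr_powr)
  then show ?thesis
    using nn_integral_gaussian_product[of 1, where 'n='n]
    by (simp add: standard_gaussian_density)
qed

section \<open>Lebesgue measure under linear maps\<close>

lemma nn_integral_lborel_shift:
  fixes f :: "'a::euclidean_space \<Rightarrow> ennreal"
  assumes [measurable]: "f \<in> borel_measurable borel"
  shows "(\<integral>\<^sup>+x. f (x + c) \<partial>lborel) = (\<integral>\<^sup>+x. f x \<partial>lborel)"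
proof -
  have "(\<integral>\<^sup>+x. f x \<partial>lborel) = (\<integral>\<^sup>+x. f x \<partial>distr lborel borel ((+) c))"
    by (simp only: lborel_distr_plus)
  also have "\<dots> = (\<integral>\<^sup>+x. f (x + c) \<partial>lborel)"
    by (simp add: nn_integral_distr add.commute)
  finally show ?thesis by simp
qed

lemma nn_integral_lborel_reflect:
  fixes f :: "'a::euclidean_space \<Rightarrow> ennreal"
  assumes [measurable]: "f \<in> borel_measurable borel"
  shows "(\<integral>\<^sup>+x. f (c - x) \<partial>lborel) = (\<integral>\<^sup>+x. f x \<partial>lborel)"
proof -
  have "lborel = distr lborel borel (\<lambda>x. c - x)"
    using lborel_affine[of "-1" c] by (simp add: density_1)
  then have "(\<integral>\<^sup>+x. f x \<partial>lborel) = (\<integral>\<^sup>+x. f x \<partial>distr lborel borel (\<lambda>x. c - x))"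
    by simp
  also have "\<dots> = (\<integral>\<^sup>+x. f (c - x) \<partial>lborel)"
    by (simp add: nn_integral_distr)
  finally show ?thesis by simp
qed

text \<open>A uniqueness argument for invariant measures.  Let \<open>g\<close> be the standard Gaussian density, which
  is invariant under \<open>Q\<close> and integrates to one.  Translation invariance and Fubini's theorem show
  that the integral of \<open>f (Q x) g y\<close> over all pairs equals that of \<open>f y g (Q x)\<close>, that is,
  the integral of \<open>f \<circ> Q\<close> equals the integral of \<open>f\<close>.\<close>

lemma lborel_orthogonal_image:
  fixes Q :: "real^'n^'n"
  assumes Q: "orthogonal_matrix Q"
  shows "distr lborel borel (\<lambda>x. Q *v x) = lborel"
proof (rule measure_eqI)
  fix A :: "(real^'n) set" assume "A \<in> sets (distr lborel borel (\<lambda>x. Q *v x))"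
  then have [measurable]: "A \<in> sets borel" by simp
  define f :: "real^'n \<Rightarrow> ennreal" where "f = indicator A"
  define g :: "real^'n \<Rightarrow> ennreal" where "g = (\<lambda>x. ennreal (gaussian_density 0 (mat 1) x))"
  have [measurable]: "f \<in> borel_measurable borel" "g \<in> borel_measurable borel"
    by (simp_all add: f_def g_def)
  have QQ: "Q *v (transpose Q *v y) = y" for y
    using Q by (simp add: orthogonal_matrix_def matrix_vector_mul_assoc del: transpose_matrix_vector)
  have gQ: "g (Q *v x) = g x" for x
    using orthogonal_matrix_norm[OF Q, of x]
    by (simp add: g_def standard_gaussian_density dot_square_norm)
  have g1: "(\<integral>\<^sup>+x. g x \<partial>lborel) = 1"
    by (simp add: g_def nn_integral_standard_gaussian_density)
  have "(\<integral>\<^sup>+x. f (Q *v x) \<partial>lborel) = (\<integral>\<^sup>+x. f (Q *v x) * (\<integral>\<^sup>+y. g (y + Q *v x) \<partial>lborel) \<partial>lborel)"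
    by (simp add: nn_integral_lborel_shift g1)
  also have "\<dots> = (\<integral>\<^sup>+x. (\<integral>\<^sup>+y. f (Q *v x) * g (y + Q *v x) \<partial>lborel) \<partial>lborel)"
    by (simp add: nn_integral_cmult)
  also have "\<dots> = (\<integral>\<^sup>+y. (\<integral>\<^sup>+x. f (Q *v x) * g (y + Q *v x) \<partial>lborel) \<partial>lborel)"
    by (rule lborel_pair.Fubini') simp
  also have "\<dots> = (\<integral>\<^sup>+y. (\<integral>\<^sup>+x. f (Q *v x - y) * g (Q *v x) \<partial>lborel) \<partial>lborel)"
  proof (rule nn_integral_cong)
    fix y :: "real^'n"
    have "(\<integral>\<^sup>+x. f (Q *v x) * g (y + Q *v x) \<partial>lborel)
        = (\<integral>\<^sup>+x. (\<lambda>x. f (Q *v x) * g (y + Q *v x)) (x + (- (transpose Q *v y))) \<partial>lborel)"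
      by (rule nn_integral_lborel_shift[symmetric]) simp
    also have "\<dots> = (\<integral>\<^sup>+x. f (Q *v x - y) * g (Q *v x) \<partial>lborel)"
      by (simp add: matrix_vector_mult_diff_distrib QQ del: transpose_matrix_vector)
    finally show "(\<integral>\<^sup>+x. f (Q *v x) * g (y + Q *v x) \<partial>lborel) = (\<integral>\<^sup>+x. f (Q *v x - y) * g (Q *v x) \<partial>lborel)" .
  qed
  also have "\<dots> = (\<integral>\<^sup>+x. (\<integral>\<^sup>+y. f (Q *v x - y) * g (Q *v x) \<partial>lborel) \<partial>lborel)"
    by (rule lborel_pair.Fubini') simp
  also have "\<dots> = (\<integral>\<^sup>+x. (\<integral>\<^sup>+y. f y \<partial>lborel) * g x \<partial>lborel)"
    by (simp add: nn_integral_multc nn_integral_lborel_reflect gQ)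
  also have "\<dots> = (\<integral>\<^sup>+y. f y \<partial>lborel)"
    by (simp add: nn_integral_cmult g1)
  finally have "(\<integral>\<^sup>+x. f (Q *v x) \<partial>lborel) = (\<integral>\<^sup>+y. f y \<partial>lborel)" .
  moreover have "(\<integral>\<^sup>+x. f (Q *v x) \<partial>lborel) = (\<integral>\<^sup>+x. f x \<partial>distr lborel borel (\<lambda>x. Q *v x))"
    by (simp add: nn_integral_distr)
  ultimately show "emeasure (distr lborel borel (\<lambda>x. Q *v x)) A = emeasure lborel A"
    by (simp add: f_def)
qed simp

lemma lborel_diag_matrix:
  assumes s: "\<And>i::'n::finite. 0 < (s i :: real)"
  shows "lborel = density (distr lborel borel (\<lambda>x. diag_matrix s *v x)) (\<lambda>_. ennreal (\<Prod>i\<in>UNIV. s i))"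
proof -
  have B: "(Basis :: (real^'n) set) = (\<lambda>i. axis i 1) ` UNIV"
    by (auto simp: Basis_vec_def)
  define c :: "real^'n \<Rightarrow> real" where "c b = s (axis_index b)" for b
  have ci: "c (axis i 1) = s i" for i by (simp add: c_def)
  have inj: "inj (\<lambda>i::'n. axis i (1::real))" by (auto simp: inj_def axis_eq_axis)
  have T: "0 + (\<Sum>j\<in>Basis. (c j * (x \<bullet> j)) *\<^sub>R j) = diag_matrix s *v x" for x
  proof -
    have "(\<Sum>j\<in>Basis. (c j * (x \<bullet> j)) *\<^sub>R j) = (\<Sum>i\<in>UNIV. (s i * x $ i) *\<^sub>R axis i 1)"
      unfolding B using inj by (simp add: sum.reindex ci inner_axis)
    also have "\<dots> = diag_matrix s *v x"
      by (simp add: diag_matrix_vector vec_eq_iff axis_def if_distrib[of "\<lambda>a. _ * a"] cong: if_cong)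
    finally show ?thesis by simp
  qed
  have p: "(\<Prod>j\<in>Basis. \<bar>c j\<bar>) = (\<Prod>i\<in>UNIV. s i)"
    unfolding B using inj s by (simp add: prod.reindex ci less_imp_le)
  have "c j \<noteq> 0" if "j \<in> Basis" for j using s[of "axis_index j"] by (simp add: c_def)
  then show ?thesis
    by (rule lborel_affine_euclidean[of c 0, unfolded T p])
qed

text \<open>The orthogonal factors of the singular value decomposition preserve Lebesgue measure and have
  determinant of modulus one, so only the coordinate scaling between them counts.\<close>

lemma lborel_eq_distr_linear:
  fixes F :: "real^'n^'n"
  assumes F: "invertible F"
  shows "lborel = density (distr lborel borel (\<lambda>x. F *v x)) (\<lambda>_. ennreal \<bar>det F\<bar>)"
proof -
  obtain P s Q where P: "orthogonal_matrix P" "\<And>i. 0 < s i" "orthogonal_matrix Q"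
    "F = P ** diag_matrix s ** Q"
    using singular_value_decomposition[OF F] by blast
  have d: "\<bar>det F\<bar> = (\<Prod>i\<in>UNIV. s i)"
    using det_orthogonal_matrix[OF P(1)] det_orthogonal_matrix[OF P(3)] P(2)
    by (auto simp: P(4) det_mul det_diag_matrix abs_mult abs_prod less_imp_le)
  have "distr lborel borel (\<lambda>x. F *v x)
      = distr (distr (distr lborel borel (\<lambda>x. Q *v x)) borel (\<lambda>x. diag_matrix s *v x)) borel (\<lambda>x. P *v x)"
    by (simp add: distr_distr o_def P(4) matrix_vector_mul_assoc matrix_mul_assoc)
  also have "\<dots> = distr (distr lborel borel (\<lambda>x. diag_matrix s *v x)) borel (\<lambda>x. P *v x)"
    by (simp only: lborel_orthogonal_image[OF P(3)])
  finally have "density (distr lborel borel (\<lambda>x. F *v x)) (\<lambda>_. ennreal \<bar>det F\<bar>)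
      = density (distr (distr lborel borel (\<lambda>x. diag_matrix s *v x)) borel (\<lambda>x. P *v x)) (\<lambda>_. ennreal (\<Prod>i\<in>UNIV. s i))"
    by (simp add: d)
  also have "\<dots> = distr (density (distr lborel borel (\<lambda>x. diag_matrix s *v x)) (\<lambda>_. ennreal (\<Prod>i\<in>UNIV. s i))) borel (\<lambda>x. P *v x)"
    by (subst density_distr) simp_all
  also have "\<dots> = lborel"
    by (simp only: lborel_diag_matrix[OF P(2), symmetric] lborel_orthogonal_image[OF P(1)])
  finally show ?thesis by simp
qed

section \<open>Gaussian measures\<close>

text \<open>Every later manipulation of Gaussian expectations goes through this representation: applying an
  affine map to the argument, and exchanging \<open>F\<close> for another matrix, become operations inside
  an integral over one fixed measure.\<close>

lemma gaussian_eq_distr: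
  fixes F :: "real^'n^'n"
  assumes F: "invertible F"
  shows "gaussian \<mu> (F ** transpose F) = distr (gaussian 0 (mat 1)) borel (\<lambda>x. \<mu> + F *v x)"
proof -
  let ?T = "\<lambda>x. \<mu> + F *v x" and ?h = "gaussian_density \<mu> (F ** transpose F)"
  have d0: "det F \<noteq> 0" using F by (simp add: invertible_det_nz)
  have [measurable]: "?T \<in> borel_measurable borel" by measurable
  have "lborel = distr lborel borel ((+) \<mu>)" by (simp add: lborel_distr_plus)
  also have "\<dots> = distr (density (distr lborel borel (\<lambda>x. F *v x)) (\<lambda>_. ennreal \<bar>det F\<bar>)) borel ((+) \<mu>)"
    by (subst lborel_eq_distr_linear[OF F, symmetric]) simp
  also have "\<dots> = density (distr (distr lborel borel (\<lambda>x. F *v x)) borel ((+) \<mu>)) (\<lambda>_. ennreal \<bar>det F\<bar>)"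
    by (subst density_distr) simp_all
  also have "distr (distr lborel borel (\<lambda>x. F *v x)) borel ((+) \<mu>) = distr lborel borel ?T"
    by (simp add: distr_distr o_def)
  finally have leb: "lborel = density (distr lborel borel ?T) (\<lambda>_. ennreal \<bar>det F\<bar>)" .
  have "gaussian \<mu> (F ** transpose F) = density (density (distr lborel borel ?T) (\<lambda>_. ennreal \<bar>det F\<bar>)) ?h"
    unfolding gaussian_eq_density by (subst leb[symmetric]) simp
  also have "\<dots> = density (distr lborel borel ?T) (\<lambda>x. ennreal \<bar>det F\<bar> * ennreal (?h x))"
    by (subst density_density_eq) simp_all
  also have "\<dots> = distr (density lborel (\<lambda>x. ennreal \<bar>det F\<bar> * ennreal (?h (?T x)))) borel ?T"
    by (subst density_distr) simp_all
  also have "(\<lambda>x. ennreal \<bar>det F\<bar> * ennreal (?h (?T x))) = (\<lambda>x. ennreal (gaussian_density 0 (mat 1) x))"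
  proof
    fix x
    have FF: "transpose F ** matrix_inv (F ** transpose F) ** F = mat 1"
    proof -
      have inv: "invertible (F ** transpose F)" using F by (simp add: invertible_mult transpose_invertible)
      have "F ** (transpose F ** matrix_inv (F ** transpose F)) = mat 1"
        using matrix_inv_works(1)[OF inv] by (simp add: matrix_mul_assoc)
      then show ?thesis by (simp only: matrix_left_right_inverse[of F])
    qed
    have "(F *v x) \<bullet> (matrix_inv (F ** transpose F) *v (F *v x)) = x \<bullet> ((transpose F ** matrix_inv (F ** transpose F) ** F) *v x)"
      by (simp add: inner_matrix_vector_transpose[of x "transpose F"] matrix_vector_mul_assoc[symmetric] del: transpose_matrix_vector)
    also have "\<dots> = x \<bullet> x" by (simp add: FF)
    finally have q: "(F *v x) \<bullet> (matrix_inv (F ** transpose F) *v (F *v x)) = x \<bullet> x" .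
    have "?h (?T x) = exp (- (x \<bullet> x) / 2) / ((2 * pi) powr (real CARD('n) / 2) * \<bar>det F\<bar>)"
      by (simp add: gaussian_density_def q det_mul)
    then have "\<bar>det F\<bar> * ?h (?T x) = gaussian_density 0 (mat 1) x"
      using d0 by (simp add: standard_gaussian_density)
    then show "ennreal \<bar>det F\<bar> * ennreal (?h (?T x)) = ennreal (gaussian_density 0 (mat 1) x)"
      by (simp add: ennreal_mult'[symmetric])
  qed
  finally show ?thesis by (simp add: gaussian_eq_density)
qed

lemma prob_space_standard_gaussian: "prob_space (gaussian 0 (mat 1) :: (real^'n) measure)"
  by (rule prob_spaceI) (simp add: gaussian_eq_density emeasure_density nn_integral_standard_gaussian_density)

lemma prob_space_gaussian:
  fixes \<Phi> :: "real^'n^'n"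
  assumes "sym_pos_def \<Phi>"
  shows "prob_space (gaussian \<mu> \<Phi>)"
proof -
  obtain F :: "real^'n^'n" where F: "invertible F" "\<Phi> = F ** transpose F"
    using sym_pos_def_square_root[OF assms] by blast
  show ?thesis
    unfolding F(2) gaussian_eq_distr[OF F(1)]
    by (rule prob_space.prob_space_distr[OF prob_space_standard_gaussian]) simp
qed

lemma gaussian_expectation_linear:
  fixes F :: "real^'n^'n"
  assumes "invertible F" and [measurable]: "f \<in> borel_measurable borel"
  shows "gaussian_expectation \<mu> (F ** transpose F) f = (\<integral>x. f (\<mu> + F *v x) \<partial>gaussian 0 (mat 1))"
  unfolding gaussian_expectation_def gaussian_eq_distr[OF assms(1)]
  by (subst integral_distr) simp_all

section \<open>Continuity of Gaussian expectations\<close>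

lemma gaussian_density_pos: "sym_pos_def \<Phi> \<Longrightarrow> 0 < gaussian_density \<mu> \<Phi> x"
  using det_sym_pos_def[of \<Phi>] by (simp add: gaussian_density_def)

lemma gaussian_expectation_eq_lborel_integral:
  assumes "sym_pos_def \<Phi>" and [measurable]: "f \<in> borel_measurable borel"
  shows "gaussian_expectation \<mu> \<Phi> f = (\<integral>x. gaussian_density \<mu> \<Phi> x * f x \<partial>lborel)"
  using gaussian_density_pos[OF assms(1)]
  by (simp add: gaussian_expectation_def gaussian_eq_density integral_density less_imp_le)

lemma AE_gaussian:
  assumes "sym_pos_def \<Phi>"
  shows "(AE x in gaussian \<mu> \<Phi>. P x) \<longleftrightarrow> (AE x in lborel. P x)"
  unfolding gaussian_eq_density
  using gaussian_density_pos[OF assms] by (subst AE_density) auto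

lemma norm_matrix_vector_le:
  fixes A :: "real^'n^'m"
  shows "norm (A *v x) \<le> norm A * norm x"
proof -
  have "norm (A *v x) \<le> L2_set (\<lambda>i. norm (A $ i) * norm x) UNIV"
    unfolding norm_vec_def[of "A *v x"]
    by (rule L2_set_mono) (simp_all add: matrix_vector_mul_component Cauchy_Schwarz_ineq2)
  also have "\<dots> = norm A * norm x"
    by (simp add: norm_vec_def[of A] L2_set_left_distrib[symmetric])
  finally show ?thesis .
qed

lemma tendsto_matrix_vector:
  fixes A :: "nat \<Rightarrow> real^'n^'m"
  assumes "A \<longlonglongrightarrow> B" "x \<longlonglongrightarrow> y"
  shows "(\<lambda>m. A m *v x m) \<longlonglongrightarrow> B *v y"
  unfolding matrix_vector_mult_def by (intro tendsto_intros assms)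

lemma tendsto_matrix_mult:
  fixes A :: "nat \<Rightarrow> real^'n^'m" and B :: "nat \<Rightarrow> real^'p^'n"
  assumes "A \<longlonglongrightarrow> A'" "B \<longlonglongrightarrow> B'"
  shows "(\<lambda>m. A m ** B m) \<longlonglongrightarrow> A' ** B'"
  unfolding matrix_matrix_mult_def by (intro tendsto_intros assms)

lemma tendsto_det:
  fixes A :: "nat \<Rightarrow> real^'n^'n"
  assumes "A \<longlonglongrightarrow> B"
  shows "(\<lambda>m. det (A m)) \<longlonglongrightarrow> det B"
  unfolding det_def by (intro tendsto_intros assms)

lemma sym_pos_def_coercive:
  fixes A :: "real^'n^'n"
  assumes "sym_pos_def A"
  obtains \<delta> where "0 < \<delta>" "\<And>x. \<delta> * (norm x)\<^sup>2 \<le> x \<bullet> (A *v x)"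
proof -
  obtain F :: "real^'n^'n" where F: "invertible F" "A = F ** transpose F"
    using sym_pos_def_square_root[OF assms] by blast
  have "inj ((*v) (transpose F))" using F(1) by (intro inj_matrix_vector_mult) (simp add: transpose_invertible)
  then obtain B where B: "B > 0" "\<And>x. B * norm x \<le> norm (transpose F *v x)"
    using linear_inj_bounded_below_pos[OF matrix_vector_mul_linear, of "transpose F"] by blast
  have "B\<^sup>2 * (norm x)\<^sup>2 \<le> x \<bullet> (A *v x)" for x
  proof -
    have "x \<bullet> (A *v x) = (transpose F *v x) \<bullet> (transpose F *v x)"
      unfolding F(2) matrix_vector_mul_assoc[symmetric] by (rule inner_matrix_vector_transpose)
    then have "x \<bullet> (A *v x) = (norm (transpose F *v x))\<^sup>2" by (simp add: dot_square_norm)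
    moreover have "(B * norm x)\<^sup>2 \<le> (norm (transpose F *v x))\<^sup>2"
      using B by (intro power_mono) auto
    ultimately show ?thesis by (simp add: power_mult_distrib)
  qed
  then show thesis using that[of "B\<^sup>2"] B(1) by simp
qed

text \<open>Half of the coercivity constant of the limit survives once the norm distance to the limit is at
  most the other half.\<close>

lemma eventually_uniformly_coercive:
  fixes \<Phi> :: "nat \<Rightarrow> real^'n^'n"
  assumes lim: "\<Phi> \<longlonglongrightarrow> \<Psi>" and spd: "sym_pos_def \<Psi>"
  obtains \<delta> where "0 < \<delta>" "\<forall>\<^sub>F m in sequentially. \<forall>x. \<delta> * (norm x)\<^sup>2 \<le> x \<bullet> (\<Phi> m *v x)"
proof -
  obtain \<delta> where \<delta>: "0 < \<delta>" "\<And>x. \<delta> * (norm x)\<^sup>2 \<le> x \<bullet> (\<Psi> *v x)"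
    using sym_pos_def_coercive[OF spd] by blast
  have "\<forall>\<^sub>F m in sequentially. dist (\<Phi> m) \<Psi> < \<delta> / 2"
    using lim \<delta>(1) by (intro tendstoD) simp_all
  then have "\<forall>\<^sub>F m in sequentially. \<forall>x. \<delta> / 2 * (norm x)\<^sup>2 \<le> x \<bullet> (\<Phi> m *v x)"
  proof eventually_elim
    case (elim m)
    show ?case
    proof
      fix x
      have "\<bar>x \<bullet> ((\<Phi> m - \<Psi>) *v x)\<bar> \<le> norm x * (norm (\<Phi> m - \<Psi>) * norm x)"
        by (rule order_trans[OF Cauchy_Schwarz_ineq2]) (simp add: mult_left_mono norm_matrix_vector_le)
      also have "\<dots> \<le> norm x * (\<delta> / 2 * norm x)"
        using elim by (intro mult_left_mono mult_right_mono) (auto simp: dist_norm)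
      finally have "\<bar>x \<bullet> ((\<Phi> m - \<Psi>) *v x)\<bar> \<le> \<delta> / 2 * (norm x)\<^sup>2"
        by (simp add: power2_eq_square mult_ac)
      moreover have "x \<bullet> (\<Phi> m *v x) = x \<bullet> (\<Psi> *v x) + x \<bullet> ((\<Phi> m - \<Psi>) *v x)"
        by (simp add: matrix_vector_mult_diff_rdistrib inner_diff_right)
      ultimately show "\<delta> / 2 * (norm x)\<^sup>2 \<le> x \<bullet> (\<Phi> m *v x)"
        using \<delta>(2)[of x] by linarith
    qed
  qed
  then show thesis using that[of "\<delta> / 2"] \<delta>(1) by simp
qed

text \<open>With \<open>e\<close> the error of the solution, \<open>\<Phi> e\<close> is the residual of the limiting solution, so
  coercivity bounds the norm of \<open>e\<close> by a multiple of the norm of this residual.\<close>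

lemma tendsto_matrix_inv_vector:
  fixes \<Phi> :: "nat \<Rightarrow> real^'n^'n"
  assumes lim: "\<Phi> \<longlonglongrightarrow> \<Psi>" and spd: "sym_pos_def \<Psi>" "\<And>m. sym_pos_def (\<Phi> m)"
    and x: "x \<longlonglongrightarrow> y"
  shows "(\<lambda>m. matrix_inv (\<Phi> m) *v x m) \<longlonglongrightarrow> matrix_inv \<Psi> *v y"
proof -
  obtain \<delta> where \<delta>: "0 < \<delta>" "\<forall>\<^sub>F m in sequentially. \<forall>x. \<delta> * (norm x)\<^sup>2 \<le> x \<bullet> (\<Phi> m *v x)"
    using eventually_uniformly_coercive[OF lim spd(1)] by blast
  define u where "u = matrix_inv \<Psi> *v y"
  define e where "e m = matrix_inv (\<Phi> m) *v x m - u" for m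
  have "(\<lambda>m. norm (x m - \<Phi> m *v u) / \<delta>) \<longlonglongrightarrow> norm (y - \<Psi> *v u) / \<delta>"
    using \<delta>(1) by (intro tendsto_intros x tendsto_matrix_vector lim) auto
  then have lim0: "(\<lambda>m. norm (x m - \<Phi> m *v u) / \<delta>) \<longlonglongrightarrow> 0"
    by (simp add: u_def matrix_inv_vector[OF spd(1)])
  have "\<forall>\<^sub>F m in sequentially. norm (e m) \<le> norm (x m - \<Phi> m *v u) / \<delta>"
    using \<delta>(2)
  proof eventually_elim
    case (elim m)
    have "\<delta> * (norm (e m))\<^sup>2 \<le> e m \<bullet> (\<Phi> m *v e m)" using elim by blast
    also have "\<Phi> m *v e m = x m - \<Phi> m *v u"
      by (simp add: e_def matrix_vector_mult_diff_distrib matrix_inv_vector[OF spd(2)])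
    also have "e m \<bullet> (x m - \<Phi> m *v u) \<le> norm (e m) * norm (x m - \<Phi> m *v u)"
      by (rule norm_cauchy_schwarz)
    finally have "norm (e m) * (\<delta> * norm (e m)) \<le> norm (e m) * norm (x m - \<Phi> m *v u)"
      by (simp add: power2_eq_square mult.left_commute)
    then have "\<delta> * norm (e m) \<le> norm (x m - \<Phi> m *v u)"
      by (cases "e m = 0") auto
    then show ?case using \<delta>(1) by (simp add: field_simps)
  qed
  then have "(\<lambda>m. matrix_inv (\<Phi> m) *v x m - u) \<longlonglongrightarrow> 0"
    unfolding e_def[symmetric] by (rule Lim_null_comparison[OF _ lim0])
  then show ?thesis unfolding u_def by (rule LIM_zero_cancel)
qed

text \<open>Substitute \<open>y = \<Phi> u\<close> in the coercivity of \<open>\<Phi>\<close>, and bound the norm of \<open>y\<close> by that of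
  \<open>u\<close>; this is what makes the Gaussian tails uniform along the sequence.\<close>

lemma eventually_inverse_coercive:
  fixes \<Phi> :: "nat \<Rightarrow> real^'n^'n"
  assumes lim: "\<Phi> \<longlonglongrightarrow> \<Psi>" and spd: "sym_pos_def \<Psi>" "\<And>m. sym_pos_def (\<Phi> m)"
  obtains \<delta> where "0 < \<delta>"
    "\<forall>\<^sub>F m in sequentially. \<forall>y. \<delta> * (norm y)\<^sup>2 \<le> y \<bullet> (matrix_inv (\<Phi> m) *v y)"
proof -
  obtain \<delta> where \<delta>: "0 < \<delta>" "\<forall>\<^sub>F m in sequentially. \<forall>x. \<delta> * (norm x)\<^sup>2 \<le> x \<bullet> (\<Phi> m *v x)"
    using eventually_uniformly_coercive[OF lim spd(1)] by blast
  have "Bseq \<Phi>" using lim by (rule convergent_imp_Bseq[OF convergentI])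
  then obtain K where K: "K > 0" "\<And>m. norm (\<Phi> m) \<le> K" by (auto elim: BseqE)
  have "\<forall>\<^sub>F m in sequentially. \<forall>y. \<delta> / K\<^sup>2 * (norm y)\<^sup>2 \<le> y \<bullet> (matrix_inv (\<Phi> m) *v y)"
    using \<delta>(2)
  proof eventually_elim
    case (elim m)
    show ?case
    proof
      fix y
      define u where "u = matrix_inv (\<Phi> m) *v y"
      have y: "\<Phi> m *v u = y" by (simp add: u_def matrix_inv_vector[OF spd(2)])
      have "norm y \<le> K * norm u"
        using norm_matrix_vector_le[of "\<Phi> m" u] K(2)[of m] mult_right_mono[of "norm (\<Phi> m)" K "norm u"]
        unfolding y by simp
      then have "(norm y)\<^sup>2 \<le> K\<^sup>2 * (norm u)\<^sup>2"
        by (metis norm_ge_zero power_mono power_mult_distrib)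
      then have "\<delta> / K\<^sup>2 * (norm y)\<^sup>2 \<le> \<delta> / K\<^sup>2 * (K\<^sup>2 * (norm u)\<^sup>2)"
        using \<delta>(1) by (intro mult_left_mono) auto
      also have "\<dots> = \<delta> * (norm u)\<^sup>2" using K(1) by simp
      also have "\<dots> \<le> u \<bullet> (\<Phi> m *v u)" using elim by blast
      also have "\<dots> = y \<bullet> u" by (simp add: y inner_commute)
      finally show "\<delta> / K\<^sup>2 * (norm y)\<^sup>2 \<le> y \<bullet> (matrix_inv (\<Phi> m) *v y)" by (simp add: u_def)
    qed
  qed
  then show thesis using that[of "\<delta> / K\<^sup>2"] \<delta>(1) K(1) by simp
qed

lemma integrable_exp_neg_square:
  assumes "0 < (c::real)"
  shows "integrable lborel (\<lambda>x::real^'n. exp (- c * (x \<bullet> x)))"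
proof -
  define s where "s = sqrt (1 / (2 * c))"
  define D where "D = sqrt (2 * pi * s\<^sup>2) ^ CARD('n)"
  have s: "0 < s" "2 * s\<^sup>2 = 1 / c" using assms by (simp_all add: s_def)
  have D: "0 < D" using s(1) by (simp add: D_def)
  have e: "- (x \<bullet> x) / (2 * s\<^sup>2) = - c * (x \<bullet> x)" for x :: "real^'n"
    using assms by (simp only: s(2)) simp
  have "integrable lborel (\<lambda>x::real^'n. exp (- c * (x \<bullet> x)) / D)"
    using nn_integral_gaussian_product[OF s(1), where 'n='n] D unfolding e D_def[symmetric]
    by (intro integrableI_nonneg) auto
  then have "integrable lborel (\<lambda>x::real^'n. D * (exp (- c * (x \<bullet> x)) / D))"
    by (rule integrable_mult_right)
  then show ?thesis using D by simp
qed

text \<open>Dominated convergence of the densities: bounded means and uniformly coercive inverse covariance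
  matrices give a common majorant of the form \<open>K exp (- c \<bar>x\<bar>\<^sup>2)\<close>.\<close>

lemma gaussian_expectation_tendsto:
  fixes \<Phi> :: "nat \<Rightarrow> real^'n^'n" and f :: "real^'n \<Rightarrow> real"
  assumes [measurable]: "f \<in> borel_measurable borel" and f: "\<And>x. 0 \<le> f x \<and> f x \<le> 1"
    and mu: "\<mu> \<longlonglongrightarrow> \<mu>'" and lim: "\<Phi> \<longlonglongrightarrow> \<Psi>"
    and spd: "sym_pos_def \<Psi>" "\<And>m. sym_pos_def (\<Phi> m)"
  shows "(\<lambda>m. gaussian_expectation (\<mu> m) (\<Phi> m) f) \<longlonglongrightarrow> gaussian_expectation \<mu>' \<Psi> f"
proof -
  obtain \<delta> where \<delta>: "0 < \<delta>"
    "\<forall>\<^sub>F m in sequentially. \<forall>y. \<delta> * (norm y)\<^sup>2 \<le> y \<bullet> (matrix_inv (\<Phi> m) *v y)"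
    using eventually_inverse_coercive[OF lim spd] by blast
  have det: "\<forall>\<^sub>F m in sequentially. det \<Psi> / 2 < det (\<Phi> m)"
    using det_sym_pos_def[OF spd(1)] by (intro order_tendstoD(1)[OF tendsto_det[OF lim]]) simp
  obtain N where N: "\<And>m y. m \<ge> N \<Longrightarrow> \<delta> * (norm y)\<^sup>2 \<le> y \<bullet> (matrix_inv (\<Phi> m) *v y)"
    "\<And>m. m \<ge> N \<Longrightarrow> det \<Psi> / 2 < det (\<Phi> m)"
    using eventually_conj[OF \<delta>(2) det] by (auto simp: eventually_sequentially)
  have "Bseq \<mu>" using mu by (rule convergent_imp_Bseq[OF convergentI])
  then obtain K where K: "K > 0" "\<And>m. norm (\<mu> m) \<le> K" by (auto elim: BseqE)
  define c where "c = (2 * pi) powr (real CARD('n) / 2)"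
  have c: "0 < c" by (simp add: c_def)
  define w where "w x = exp (\<delta> * K\<^sup>2 / 2) / (c * sqrt (det \<Psi> / 2)) * exp (- (\<delta> / 4) * (x \<bullet> x))" for x :: "real^'n"
  \<comment> \<open>The majorant arises from \<open>\<bar>x - \<mu>\<bar>\<^sup>2 \<ge> \<bar>x\<bar>\<^sup>2 / 2 - \<bar>\<mu>\<bar>\<^sup>2\<close>.\<close>
  have bound: "gaussian_density (\<mu> m) (\<Phi> m) x \<le> w x" if m: "m \<ge> N" for m x
  proof -
    define q where "q = (x - \<mu> m) \<bullet> (matrix_inv (\<Phi> m) *v (x - \<mu> m))"
    have "(norm x)\<^sup>2 \<le> (norm (x - \<mu> m) + norm (\<mu> m))\<^sup>2"
      using norm_triangle_sub[of x "\<mu> m"] by (intro power_mono) (simp_all add: add.commute)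
    also have "\<dots> \<le> 2 * (norm (x - \<mu> m))\<^sup>2 + 2 * (norm (\<mu> m))\<^sup>2"
      using zero_le_power2[of "norm (x - \<mu> m) - norm (\<mu> m)"] by (simp add: power2_eq_square algebra_simps)
    also have "(norm (\<mu> m))\<^sup>2 \<le> K\<^sup>2" using K(2) by (intro power_mono) auto
    finally have "(norm x)\<^sup>2 / 2 - K\<^sup>2 \<le> (norm (x - \<mu> m))\<^sup>2" by simp
    then have "\<delta> * ((norm x)\<^sup>2 / 2 - K\<^sup>2) \<le> \<delta> * (norm (x - \<mu> m))\<^sup>2"
      using \<delta>(1) by (intro mult_left_mono) auto
    also have "\<dots> \<le> q" unfolding q_def by (rule N(1)[OF m])
    finally have "- q / 2 \<le> \<delta> * K\<^sup>2 / 2 + - (\<delta> / 4) * (x \<bullet> x)"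
      by (simp add: dot_square_norm algebra_simps)
    then have "- ((x - \<mu> m) \<bullet> (matrix_inv (\<Phi> m) *v (x - \<mu> m))) / 2 \<le> \<delta> * K\<^sup>2 / 2 + - (\<delta> / 4) * (x \<bullet> x)"
      by (simp only: q_def)
    then have "exp (- ((x - \<mu> m) \<bullet> (matrix_inv (\<Phi> m) *v (x - \<mu> m))) / 2)
        \<le> exp (\<delta> * K\<^sup>2 / 2) * exp (- (\<delta> / 4) * (x \<bullet> x))"
      by (simp add: exp_add[symmetric])
    moreover have "c * sqrt (det \<Psi> / 2) \<le> c * sqrt (det (\<Phi> m))"
      using c N(2)[OF m] by (intro mult_left_mono real_sqrt_le_mono) auto
    moreover have "0 < c * sqrt (det \<Psi> / 2)" using c det_sym_pos_def[OF spd(1)] by simp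
    ultimately have "gaussian_density (\<mu> m) (\<Phi> m) x
        \<le> exp (\<delta> * K\<^sup>2 / 2) * exp (- (\<delta> / 4) * (x \<bullet> x)) / (c * sqrt (det \<Psi> / 2))"
      unfolding gaussian_density_def c_def[symmetric] by (intro frac_le) auto
    then show ?thesis by (simp add: w_def)
  qed
  have "(\<lambda>m. \<integral>x. gaussian_density (\<mu> (m + N)) (\<Phi> (m + N)) x * f x \<partial>lborel)
      \<longlonglongrightarrow> (\<integral>x. gaussian_density \<mu>' \<Psi> x * f x \<partial>lborel)"
  proof (rule integral_dominated_convergence)
    show "integrable lborel w"
      unfolding w_def[abs_def] using \<delta>(1) by (intro integrable_mult_right integrable_exp_neg_square) simp
    show "AE x in lborel. norm (gaussian_density (\<mu> (m + N)) (\<Phi> (m + N)) x * f x) \<le> w x" for m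
    proof (rule AE_I2)
      fix x :: "real^'n"
      have "gaussian_density (\<mu> (m + N)) (\<Phi> (m + N)) x * f x \<le> gaussian_density (\<mu> (m + N)) (\<Phi> (m + N)) x * 1"
        using f gaussian_density_pos[OF spd(2)] by (intro mult_left_mono) (auto simp: less_imp_le)
      also have "\<dots> \<le> w x" using bound[of "m + N" x] by simp
      finally show "norm (gaussian_density (\<mu> (m + N)) (\<Phi> (m + N)) x * f x) \<le> w x"
        using f[of x] gaussian_density_pos[OF spd(2)] by (simp add: abs_mult less_imp_le)
    qed
    show "AE x in lborel. (\<lambda>m. gaussian_density (\<mu> (m + N)) (\<Phi> (m + N)) x * f x)
        \<longlonglongrightarrow> gaussian_density \<mu>' \<Psi> x * f x"
    proof (rule AE_I2)
      fix x :: "real^'n"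
      have "(\<lambda>m. gaussian_density (\<mu> m) (\<Phi> m) x) \<longlonglongrightarrow> gaussian_density \<mu>' \<Psi> x"
        unfolding gaussian_density_def
        using det_sym_pos_def[OF spd(1)]
        by (intro tendsto_intros tendsto_matrix_inv_vector tendsto_det lim spd mu) auto
      then have "(\<lambda>m. gaussian_density (\<mu> m) (\<Phi> m) x * f x) \<longlonglongrightarrow> gaussian_density \<mu>' \<Psi> x * f x"
        by (intro tendsto_intros)
      then show "(\<lambda>m. gaussian_density (\<mu> (m + N)) (\<Phi> (m + N)) x * f x)
        \<longlonglongrightarrow> gaussian_density \<mu>' \<Psi> x * f x"
        by (rule LIMSEQ_ignore_initial_segment)
    qed
  qed measurable
  then have "(\<lambda>m. gaussian_expectation (\<mu> (m + N)) (\<Phi> (m + N)) f) \<longlonglongrightarrow> gaussian_expectation \<mu>' \<Psi> f"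
    by (simp add: gaussian_expectation_eq_lborel_integral spd)
  then show ?thesis by (rule LIMSEQ_offset)
qed

section \<open>Strict bounds for nontrivial tests\<close>

lemma integrable_gaussian:
  assumes "sym_pos_def \<Phi>" "f \<in> borel_measurable borel" "\<And>x. 0 \<le> f x \<and> f x \<le> (1::real)"
  shows "integrable (gaussian \<mu> \<Phi>) f"
proof -
  interpret prob_space "gaussian \<mu> \<Phi>" by (rule prob_space_gaussian[OF assms(1)])
  show ?thesis using assms(2,3) by (intro integrable_const_bound[where B=1]) auto
qed

lemma gaussian_expectation_bounds:
  assumes "sym_pos_def \<Phi>" "f \<in> borel_measurable borel" "\<And>x. 0 \<le> f x \<and> f x \<le> (1::real)"
  shows "0 \<le> gaussian_expectation \<mu> \<Phi> f" "gaussian_expectation \<mu> \<Phi> f \<le> 1"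
proof -
  interpret prob_space "gaussian \<mu> \<Phi>" by (rule prob_space_gaussian[OF assms(1)])
  show "0 \<le> gaussian_expectation \<mu> \<Phi> f"
    using assms(3) by (simp add: gaussian_expectation_def)
  show "gaussian_expectation \<mu> \<Phi> f \<le> 1"
    unfolding gaussian_expectation_def using assms(3)
    by (intro integral_le_const integrable_gaussian assms) auto
qed

text \<open>The Gaussian density is positive everywhere, so Gaussian and Lebesgue null sets coincide.\<close>

lemma gaussian_expectation_pos:
  assumes spd: "sym_pos_def \<Phi>" and f: "f \<in> borel_measurable borel" "\<And>x. 0 \<le> f x \<and> f x \<le> (1::real)"
    and not0: "\<not> (AE x in lborel. f x = 0)"
  shows "0 < gaussian_expectation \<mu> \<Phi> f"
proof -
  have "gaussian_expectation \<mu> \<Phi> f = 0 \<longleftrightarrow> (AE x in gaussian \<mu> \<Phi>. f x = 0)"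
    unfolding gaussian_expectation_def
    using f by (intro integral_nonneg_eq_0_iff_AE integrable_gaussian spd) auto
  then show ?thesis
    using not0 gaussian_expectation_bounds(1)[OF spd f, of \<mu>] by (simp add: AE_gaussian[OF spd] less_le)
qed

lemma gaussian_expectation_less_one:
  assumes spd: "sym_pos_def \<Phi>" and f: "f \<in> borel_measurable borel" "\<And>x. 0 \<le> f x \<and> f x \<le> (1::real)"
    and not1: "\<not> (AE x in lborel. f x = 1)"
  shows "gaussian_expectation \<mu> \<Phi> f < 1"
proof -
  interpret prob_space "gaussian \<mu> \<Phi>" by (rule prob_space_gaussian[OF spd])
  have "0 < gaussian_expectation \<mu> \<Phi> (\<lambda>x. 1 - f x)"
    using f not1 by (intro gaussian_expectation_pos spd) auto
  also have "\<dots> = 1 - gaussian_expectation \<mu> \<Phi> f"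
    unfolding gaussian_expectation_def
    by (subst Bochner_Integration.integral_diff) (auto intro: integrable_gaussian[OF spd f] simp: prob_space[simplified])
  finally show ?thesis by simp
qed

section \<open>Almost invariant tests\<close>

lemma gaussian_expectation_affine:
  fixes \<Phi> :: "real^'n^'n"
  assumes spd: "sym_pos_def \<Phi>" and [measurable]: "f \<in> borel_measurable borel" and \<alpha>: "\<alpha> \<noteq> 0"
  shows "gaussian_expectation (\<alpha> *\<^sub>R (\<mu> - a) + b) (\<alpha>\<^sup>2 *\<^sub>R \<Phi>) f
       = gaussian_expectation \<mu> \<Phi> (\<lambda>y. f (\<alpha> *\<^sub>R (y - a) + b))"
proof -
  obtain F :: "real^'n^'n" where F: "invertible F" "\<Phi> = F ** transpose F"
    using sym_pos_def_square_root[OF spd] by blast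
  have eq: "\<alpha>\<^sup>2 *\<^sub>R \<Phi> = (\<alpha> *\<^sub>R F) ** transpose (\<alpha> *\<^sub>R F)"
    by (simp add: F(2) transpose_scalar matrix_scalar_ac scalar_matrix_assoc[symmetric] power2_eq_square)
  have inv: "invertible (\<alpha> *\<^sub>R F)" using F(1) \<alpha> by (simp add: scalar_invertible)
  have "gaussian_expectation (\<alpha> *\<^sub>R (\<mu> - a) + b) (\<alpha>\<^sup>2 *\<^sub>R \<Phi>) f
      = (\<integral>x. f (\<alpha> *\<^sub>R (\<mu> - a) + b + (\<alpha> *\<^sub>R F) *v x) \<partial>gaussian 0 (mat 1))"
    unfolding eq by (rule gaussian_expectation_linear[OF inv]) measurable
  also have "\<dots> = (\<integral>x. f (\<alpha> *\<^sub>R (\<mu> + F *v x - a) + b) \<partial>gaussian 0 (mat 1))"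
    by (simp add: scaleR_matrix_vector_assoc[symmetric] algebra_simps)
  also have "\<dots> = gaussian_expectation \<mu> \<Phi> (\<lambda>y. f (\<alpha> *\<^sub>R (y - a) + b))"
    unfolding F(2) by (subst gaussian_expectation_linear[OF F(1)]) simp_all
  finally show ?thesis .
qed

text \<open>The exceptional set of a single group element is a Lebesgue null set, which the expectation does
  not see; so almost invariance acts on expectations exactly like invariance.\<close>

lemma almost_invariant_expectation:
  assumes inv: "almost_invariant (invariance_group M0) \<phi>" and meas[measurable]: "\<phi> \<in> borel_measurable borel"
    and M0: "a \<in> M0" "b \<in> M0" and \<alpha>: "\<alpha> \<noteq> 0" and spd: "sym_pos_def \<Phi>"
  shows "gaussian_expectation (\<alpha> *\<^sub>R (\<mu> - a) + b) (\<alpha>\<^sup>2 *\<^sub>R \<Phi>) \<phi> = gaussian_expectation \<mu> \<Phi> \<phi>"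
proof -
  have g: "(\<lambda>y. \<alpha> *\<^sub>R (y - a) + b) \<in> invariance_group M0"
    using M0 \<alpha> by (auto simp: invariance_group_def)
  obtain N where N: "N \<in> sets borel" "emeasure lborel N = 0"
    "\<And>y. y \<notin> N \<Longrightarrow> \<phi> (\<alpha> *\<^sub>R (y - a) + b) = \<phi> y"
    using bspec[OF inv[unfolded almost_invariant_def] g] by (elim bexE conjE) auto
  have "AE y in lborel. \<phi> (\<alpha> *\<^sub>R (y - a) + b) = \<phi> y"
    using N by (intro AE_I'[of N]) auto
  then have "AE y in gaussian \<mu> \<Phi>. \<phi> (\<alpha> *\<^sub>R (y - a) + b) = \<phi> y"
    by (simp add: AE_gaussian[OF spd])
  then have "gaussian_expectation \<mu> \<Phi> (\<lambda>y. \<phi> (\<alpha> *\<^sub>R (y - a) + b)) = gaussian_expectation \<mu> \<Phi> \<phi>"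
    unfolding gaussian_expectation_def by (intro integral_cong_AE) simp_all
  then show ?thesis
    by (simp only: gaussian_expectation_affine[OF spd meas \<alpha>])
qed

section \<open>Orthogonal projections\<close>

lemma orth_proj_mem:
  assumes "subspace L"
  shows "orth_proj L x \<in> L" "x - orth_proj L x \<in> orthogonal_comp L"
  using theI'[OF orth_proj_unique_exists[OF assms, of x]] by (simp_all add: orth_proj_def)

lemma orth_proj_eqI:
  assumes "subspace L" "p \<in> L" "x - p \<in> orthogonal_comp L"
  shows "orth_proj L x = p"
  using orth_proj_unique_exists[OF assms(1), of x] orth_proj_mem[OF assms(1), of x] assms(2,3) by blast

lemma linear_orth_proj:
  assumes L: "subspace L"
  shows "linear (orth_proj L)"
proof (rule linearI)
  have K: "subspace (orthogonal_comp L)" by (rule subspace_orthogonal_comp)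
  fix x y c
  show "orth_proj L (x + y) = orth_proj L x + orth_proj L y"
    using subspace_add[OF K orth_proj_mem(2)[OF L, of x] orth_proj_mem(2)[OF L, of y]]
    by (intro orth_proj_eqI L subspace_add orth_proj_mem) (simp add: algebra_simps)
  show "orth_proj L (c *\<^sub>R x) = c *\<^sub>R orth_proj L x"
    using subspace_scale[OF K orth_proj_mem(2)[OF L, of x], of c]
    by (intro orth_proj_eqI L subspace_scale orth_proj_mem) (simp add: algebra_simps)
qed

lemma orth_proj_id: "subspace L \<Longrightarrow> x \<in> L \<Longrightarrow> orth_proj L x = x"
  by (rule orth_proj_eqI) (auto simp: orthogonal_comp_def orthogonal_def)

lemma orth_proj_zero: "subspace L \<Longrightarrow> x \<in> orthogonal_comp L \<Longrightarrow> orth_proj L x = 0"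
  by (rule orth_proj_eqI) (auto simp: subspace_0)

lemma orthogonal_comp_inner: "x \<in> L \<Longrightarrow> y \<in> orthogonal_comp L \<Longrightarrow> x \<bullet> y = 0"
  by (simp add: orthogonal_comp_def orthogonal_def)

lemma inner_orth_proj:
  assumes L: "subspace L" and x: "x \<in> L"
  shows "x \<bullet> orth_proj L y = x \<bullet> y"
  using orthogonal_comp_inner[OF x orth_proj_mem(2)[OF L, of y]] by (simp add: inner_diff_right)

lemma norm_orth_proj_le:
  assumes L: "subspace L"
  shows "norm (orth_proj L x) \<le> norm x"
proof -
  have "(norm (orth_proj L x))\<^sup>2 = orth_proj L x \<bullet> x"
    using inner_orth_proj[OF L orth_proj_mem(1)[OF L, of x], of x] by (simp add: dot_square_norm)
  also have "\<dots> \<le> norm (orth_proj L x) * norm x" by (rule norm_cauchy_schwarz)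
  finally show ?thesis by (cases "orth_proj L x = 0") (auto simp: power2_eq_square)
qed

lemma orth_proj_comp_mem:
  assumes W: "subspace W"
  shows "x - orth_proj (orthogonal_comp W) x \<in> W"
  using orth_proj_mem(2)[OF subspace_orthogonal_comp, of x W] by (simp add: orthogonal_comp_self[OF W])

lemma orth_proj_comp_eq:
  assumes W: "subspace W"
  shows "orth_proj W x = x - orth_proj (orthogonal_comp W) x"
  by (rule orth_proj_eqI[OF W orth_proj_comp_mem[OF W]]) (simp add: orth_proj_mem subspace_orthogonal_comp)

lemma orth_proj_comp_zero_iff:
  assumes W: "subspace W"
  shows "orth_proj (orthogonal_comp W) x = 0 \<longleftrightarrow> x \<in> W"
proof
  assume "orth_proj (orthogonal_comp W) x = 0"
  then show "x \<in> W" using orth_proj_comp_mem[OF W, of x] by simp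
next
  assume "x \<in> W"
  then show "orth_proj (orthogonal_comp W) x = 0"
    by (intro orth_proj_zero subspace_orthogonal_comp) (simp add: orthogonal_comp_self[OF W])
qed

lemma orth_proj_matrix_vector:
  fixes L :: "(real^'n) set"
  assumes "subspace L"
  shows "orth_proj_matrix L *v x = orth_proj L x"
  using matrix_works linear_orth_proj[OF assms] by (simp add: orth_proj_matrix_def)

lemma matrix_eq_by_inner:
  fixes A B :: "real^'n^'m"
  assumes "\<And>x y. x \<bullet> (A *v y) = x \<bullet> (B *v y)"
  shows "A = B"
  unfolding matrix_eq using assms by (metis vector_eq_ldot)

lemma transpose_orth_proj_matrix:
  fixes L :: "(real^'n) set"
  assumes L: "subspace L"
  shows "transpose (orth_proj_matrix L) = orth_proj_matrix L"
proof (rule matrix_eq_by_inner)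
  fix x y :: "real^'n"
  have "x \<bullet> (transpose (orth_proj_matrix L) *v y) = orth_proj L x \<bullet> y"
    using inner_matrix_vector_transpose[of x "transpose (orth_proj_matrix L)" y]
    by (simp only: transpose_transpose orth_proj_matrix_vector[OF L])
  also have "\<dots> = orth_proj L x \<bullet> orth_proj L y"
    by (rule inner_orth_proj[OF L orth_proj_mem(1)[OF L], symmetric])
  also have "\<dots> = x \<bullet> orth_proj L y"
    using inner_orth_proj[OF L orth_proj_mem(1)[OF L, of y], of x] by (simp add: inner_commute)
  finally show "x \<bullet> (transpose (orth_proj_matrix L) *v y) = x \<bullet> (orth_proj_matrix L *v y)"
    by (simp only: orth_proj_matrix_vector[OF L])
qed

lemma transpose_add:
  fixes A B :: "real^'n^'m"
  shows "transpose (A + B) = transpose A + transpose B"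
  by (simp add: transpose_def vec_eq_iff)

lemma matrix_mult_add_rdistrib:
  fixes A B :: "real^'n^'m" and C :: "real^'p^'n"
  shows "(A + B) ** C = A ** C + B ** C"
  by (simp add: matrix_matrix_mult_def vec_eq_iff sum.distrib distrib_right)

section \<open>Changing the covariance along directions of invariance\<close>

text \<open>The isometry from \<open>K\<close> onto \<open>W\<close>, extended by zero on the orthogonal complement of
  \<open>K\<close>; its transpose is the inverse isometry, extended by zero in the same way.\<close>

lemma partial_isometry_between_subspaces:
  fixes K W :: "(real^'n) set"
  assumes K: "subspace K" and W: "subspace W" and dim: "dim K = dim W"
  obtains T :: "real^'n^'n" where "\<And>x. T *v x \<in> W" "\<And>y. transpose T *v y \<in> K"
    "\<And>y. T *v (transpose T *v y) = orth_proj W y" "\<And>x. x \<in> K \<Longrightarrow> norm (T *v x) = norm x"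
proof -
  obtain f g where fg: "linear f" "linear g" "f ` K = W" "g ` W = K"
    "\<And>x. x \<in> K \<Longrightarrow> norm (f x) = norm x" "\<And>x. x \<in> W \<Longrightarrow> norm (g x) = norm x"
    "\<And>x. x \<in> K \<Longrightarrow> g (f x) = x" "\<And>x. x \<in> W \<Longrightarrow> f (g x) = x"
    using isometries_subspaces[OF K W dim] by blast
  have iso: "f a \<bullet> f b = a \<bullet> b" if "a \<in> K" "b \<in> K" for a b
    using that K fg(1) by (simp add: dot_norm[of "f a"] dot_norm[of a] linear_add[symmetric] fg(5) subspace_add)
  define T where "T = matrix (\<lambda>x. f (orth_proj K x))"
  have lin: "linear (\<lambda>x. f (orth_proj K x))"
    using linear_compose[OF linear_orth_proj[OF K] fg(1)] by (simp add: o_def)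
  have T: "T *v x = f (orth_proj K x)" for x
    using matrix_works lin by (simp add: T_def)
  have fW: "f x \<in> W" if "x \<in> K" for x using fg(3) that by blast
  have gK: "g x \<in> K" if "x \<in> W" for x using fg(4) that by blast
  have Tt: "transpose T *v y = g (orth_proj W y)" for y
  proof -
    have "x \<bullet> (transpose T *v y) = x \<bullet> g (orth_proj W y)" for x
    proof -
      have "x \<bullet> (transpose T *v y) = f (orth_proj K x) \<bullet> y"
        using inner_matrix_vector_transpose[of x "transpose T" y] by (simp only: transpose_transpose T)
      also have "\<dots> = f (orth_proj K x) \<bullet> orth_proj W y"
        by (rule inner_orth_proj[OF W fW[OF orth_proj_mem(1)[OF K]], symmetric])
      also have "\<dots> = f (orth_proj K x) \<bullet> f (g (orth_proj W y))"
        by (simp add: fg(8) orth_proj_mem(1)[OF W])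
      also have "\<dots> = orth_proj K x \<bullet> g (orth_proj W y)"
        by (intro iso gK orth_proj_mem K W)
      also have "\<dots> = x \<bullet> g (orth_proj W y)"
        using inner_orth_proj[OF K gK[OF orth_proj_mem(1)[OF W, of y]], of x] by (simp add: inner_commute)
      finally show ?thesis .
    qed
    then show ?thesis by (metis vector_eq_ldot)
  qed
  show thesis
  proof (rule that)
    show "T *v x \<in> W" for x by (simp add: T fW orth_proj_mem(1)[OF K])
    show "transpose T *v y \<in> K" for y unfolding Tt by (intro gK orth_proj_mem W)
    show "T *v (transpose T *v y) = orth_proj W y" for y
      unfolding Tt T by (simp add: orth_proj_id K gK orth_proj_mem(1)[OF W] fg(8))
    show "norm (T *v x) = norm x" if "x \<in> K" for x using that by (simp add: T orth_proj_id K fg(5))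
  qed
qed

text \<open>A function that is constant along \<open>W\<close> sees only the component of a Gaussian vector orthogonal
  to \<open>W\<close>, hence only the block \<open>P \<Sigma> P\<close> of its covariance matrix.  The remaining blocks may
  be replaced by those of any other covariance matrix with the same \<open>P \<Sigma> P\<close>; the simplest
  choice makes the \<open>W\<close>-component independent with covariance \<open>s\<close> times the identity.

  Both matrices are realized on the same standard Gaussian vector: with \<open>\<Sigma> = F F\<^sup>T\<close> and
  \<open>T\<close> a partial isometry from \<open>K\<close>, the preimage of \<open>W\<close> under \<open>F\<close>, onto \<open>W\<close>, the
  matrix \<open>F' = P F + \<surd>s T\<close> factors the new covariance matrix, and \<open>F x - F' x\<close> lies in
  \<open>W\<close> for every \<open>x\<close>.\<close>

lemma gaussian_expectation_mod_subspace:
  fixes \<Sigma> :: "real^'n^'n" and W :: "(real^'n) set"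
  defines "P \<equiv> orth_proj_matrix (orthogonal_comp W)"
  assumes W: "subspace W" and spd: "sym_pos_def \<Sigma>" and s: "0 < s"
    and meas: "\<phi> \<in> borel_measurable borel"
    and inv: "\<forall>x. \<forall>z\<in>W. \<phi> (x + z) = \<phi> x"
  shows "sym_pos_def (P ** \<Sigma> ** P + s *\<^sub>R (mat 1 - P))"
    and "gaussian_expectation \<mu> \<Sigma> \<phi> = gaussian_expectation \<mu> (P ** \<Sigma> ** P + s *\<^sub>R (mat 1 - P)) \<phi>"
proof -
  let ?L = "orthogonal_comp W"
  have L: "subspace ?L" by (rule subspace_orthogonal_comp)
  have Pv: "P *v x = orth_proj ?L x" for x unfolding P_def by (rule orth_proj_matrix_vector[OF L])
  have Pt: "transpose P = P" unfolding P_def by (rule transpose_orth_proj_matrix[OF L])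
  obtain F :: "real^'n^'n" where F: "invertible F" "\<Sigma> = F ** transpose F"
    using sym_pos_def_square_root[OF spd] by blast
  define K where "K = (\<lambda>x. F *v x) -` W"
  have K: "subspace K" unfolding K_def using W by (intro linear_subspace_vimage matrix_vector_mul_linear)
  have bij: "bij ((*v) F)" using F(1) by (simp add: invertible_eq_bij)
  have "(\<lambda>x. F *v x) ` K = W" unfolding K_def using bij by (simp add: bij_is_surj surj_image_vimage_eq)
  moreover have "dim ((\<lambda>x. F *v x) ` K) = dim K"
    using bij by (intro dim_image_eq) (auto simp: bij_def intro: inj_on_subset)
  ultimately have dim: "dim K = dim W" by simp
  obtain T :: "real^'n^'n" where T: "\<And>x. T *v x \<in> W" "\<And>y. transpose T *v y \<in> K"
    "\<And>y. T *v (transpose T *v y) = orth_proj W y" "\<And>x. x \<in> K \<Longrightarrow> norm (T *v x) = norm x"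
    using partial_isometry_between_subspaces[OF K W dim] by blast
  define F' where "F' = P ** F + sqrt s *\<^sub>R T"
  have F'v: "F' *v x = P *v (F *v x) + sqrt s *\<^sub>R (T *v x)" for x
    by (simp add: F'_def matrix_vector_mult_add_rdistrib matrix_vector_mul_assoc scaleR_matrix_vector_assoc)
  \<comment> \<open>The cross terms of \<open>F' F'\<^sup>T\<close> vanish because \<open>T\<^sup>T\<close> maps into \<open>K\<close>, \<open>F\<close> maps \<open>K\<close> into \<open>W\<close>, and \<open>P\<close> kills \<open>W\<close>.\<close>
  have PFT: "P ** F ** transpose T = 0"
    unfolding matrix_eq
  proof
    fix y
    have "F *v (transpose T *v y) \<in> W" using T(2)[of y] by (simp add: K_def del: transpose_matrix_vector)
    then have "P *v (F *v (transpose T *v y)) = 0"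
      unfolding Pv by (simp only: orth_proj_comp_zero_iff[OF W])
    then show "(P ** F ** transpose T) *v y = 0 *v y"
      by (simp add: matrix_vector_mul_assoc[symmetric] del: transpose_matrix_vector)
  qed
  have TFP: "T ** transpose F ** P = 0"
  proof -
    have "transpose (P ** F ** transpose T) = T ** transpose F ** P"
      by (simp add: matrix_transpose_mul Pt matrix_mul_assoc)
    then show ?thesis unfolding PFT by (simp add: transpose_def vec_eq_iff)
  qed
  have TT: "T ** transpose T = mat 1 - P"
    unfolding matrix_eq
    by (simp add: matrix_vector_mul_assoc[symmetric] T(3) orth_proj_comp_eq[OF W]
        matrix_vector_mult_diff_rdistrib Pv del: transpose_matrix_vector)
  have "F' ** transpose F' = P ** F ** transpose F ** P + sqrt s *\<^sub>R (P ** F ** transpose T)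
      + (sqrt s *\<^sub>R (T ** transpose F ** P) + (sqrt s * sqrt s) *\<^sub>R (T ** transpose T))"
  proof -
    have "transpose F' = transpose F ** P + sqrt s *\<^sub>R transpose T"
      by (simp add: F'_def transpose_add matrix_transpose_mul Pt transpose_scalar)
    then show ?thesis
      by (simp add: F'_def matrix_add_ldistrib matrix_mult_add_rdistrib matrix_scalar_ac
          scalar_matrix_assoc[symmetric] matrix_mul_assoc scaleR_add_right)
  qed
  then have FF: "F' ** transpose F' = P ** \<Sigma> ** P + s *\<^sub>R (mat 1 - P)"
    using s by (simp add: PFT TFP TT F(2) matrix_mul_assoc)
  have "x = 0" if "F' *v x = 0" for x
  proof -
    have eq: "P *v (F *v x) = - (sqrt s *\<^sub>R (T *v x))" using that by (simp add: F'v eq_neg_iff_add_eq_0)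
    have "- (sqrt s *\<^sub>R (T *v x)) \<in> W" using W T(1) by (intro subspace_neg subspace_scale)
    moreover have "P *v (F *v x) \<in> ?L" unfolding Pv by (rule orth_proj_mem[OF L])
    ultimately have "(P *v (F *v x)) \<bullet> (P *v (F *v x)) = 0"
      using orthogonal_comp_inner unfolding eq by blast
    then have PF: "P *v (F *v x) = 0" by simp
    then have "x \<in> K" unfolding Pv by (simp add: orth_proj_comp_zero_iff[OF W] K_def)
    moreover have "T *v x = 0" using eq s by (simp add: PF)
    ultimately show "x = 0" using T(4) by fastforce
  qed
  then have "\<exists>B. B ** F' = mat 1" by (simp only: matrix_left_invertible_ker) blast
  then have inv': "invertible F'" by (simp add: invertible_left_inverse)
  show "sym_pos_def (P ** \<Sigma> ** P + s *\<^sub>R (mat 1 - P))"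
    unfolding FF[symmetric] by (rule sym_pos_def_mult_transpose[OF inv'])
  have "\<phi> (\<mu> + F *v x) = \<phi> (\<mu> + F' *v x)" for x
  proof -
    have "(F *v x - orth_proj ?L (F *v x)) - sqrt s *\<^sub>R (T *v x) \<in> W"
      using W T(1) by (intro subspace_diff subspace_scale orth_proj_comp_mem)
    then have "F *v x - F' *v x \<in> W" by (simp add: F'v Pv diff_diff_add)
    then have "\<phi> (\<mu> + F' *v x + (F *v x - F' *v x)) = \<phi> (\<mu> + F' *v x)" using inv by blast
    then show ?thesis by simp
  qed
  then have "gaussian_expectation \<mu> (F ** transpose F) \<phi> = gaussian_expectation \<mu> (F' ** transpose F') \<phi>"
    by (simp add: gaussian_expectation_linear[OF F(1) meas] gaussian_expectation_linear[OF inv' meas])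
  then show "gaussian_expectation \<mu> \<Sigma> \<phi> = gaussian_expectation \<mu> (P ** \<Sigma> ** P + s *\<^sub>R (mat 1 - P)) \<phi>"
    by (simp only: FF F(2)[symmetric])
qed

section \<open>Limits of covariance matrices\<close>

lemma psd_limit:
  fixes S :: "nat \<Rightarrow> real^'n^'n"
  assumes "S \<longlonglongrightarrow> T" "\<And>m. sym_pos_def (S m)"
  shows "transpose T = T" "0 \<le> x \<bullet> (T *v x)"
proof -
  have lim: "(\<lambda>m. S m $ j $ i) \<longlonglongrightarrow> T $ j $ i" for i j
    by (intro tendsto_intros assms)
  have symm: "S m $ j $ i = S m $ i $ j" for m i j
  proof -
    have "transpose (S m) $ i $ j = S m $ i $ j" using assms(2)[of m] by (simp add: sym_pos_def_def)
    then show ?thesis by (simp add: transpose_def)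
  qed
  have "T $ j $ i = T $ i $ j" for i j
  proof -
    have "(\<lambda>m. S m $ i $ j) \<longlonglongrightarrow> T $ j $ i"
      by (subst symm) (rule lim)
    then show ?thesis by (rule LIMSEQ_unique) (rule lim)
  qed
  then show "transpose T = T" by (simp add: transpose_def vec_eq_iff)
  have "(\<lambda>m. x \<bullet> (S m *v x)) \<longlonglongrightarrow> x \<bullet> (T *v x)"
    by (intro tendsto_inner tendsto_matrix_vector assms tendsto_const)
  moreover have "0 \<le> x \<bullet> (S m *v x)" for m
    using assms(2)[of m] by (cases "x = 0") (auto simp: sym_pos_def_def less_imp_le)
  ultimately show "0 \<le> x \<bullet> (T *v x)" by (intro LIMSEQ_le_const) auto
qed

lemma psd_null_vector:
  fixes A :: "real^'n^'n"
  assumes "transpose A = A" "\<And>x. 0 \<le> x \<bullet> (A *v x)" "v \<bullet> (A *v v) = 0"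
  shows "A *v v = 0"
  using psd_form_null_vector[OF assms(1) subspace_UNIV assms(2) UNIV_I assms(3), of "A *v v"] by simp

lemma nonsingular_limit_sym_pos_def:
  fixes S :: "nat \<Rightarrow> real^'n^'n"
  assumes "S \<longlonglongrightarrow> T" "\<And>m. sym_pos_def (S m)" "det T \<noteq> 0"
  shows "sym_pos_def T"
  unfolding sym_pos_def_def
proof (intro conjI allI impI)
  show "transpose T = T" by (rule psd_limit(1)[OF assms(1,2)])
  fix x :: "real^'n" assume "x \<noteq> 0"
  have "x \<bullet> (T *v x) \<noteq> 0"
  proof
    assume "x \<bullet> (T *v x) = 0"
    then have "T *v x = 0" by (intro psd_null_vector psd_limit[OF assms(1,2)])
    then show False
      using \<open>x \<noteq> 0\<close> assms(3) by (metis inj_matrix_vector_mult injD invertible_det_nz matrix_vector_mult_0_right)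
  qed
  then show "0 < x \<bullet> (T *v x)" using psd_limit(2)[OF assms(1,2), of x] by simp
qed

text \<open>The column space of a singular matrix is a proper subspace.\<close>

lemma singular_orthogonal_vector:
  fixes T :: "real^'n^'n"
  assumes "det T = 0"
  obtains x where "x \<noteq> 0" "x \<in> orthogonal_comp (span (columns T))"
proof -
  have "\<not> invertible (transpose T)" using assms by (simp add: invertible_det_nz)
  then have "\<not> (\<exists>B. B ** transpose T = mat 1)" by (simp add: invertible_left_inverse)
  then obtain x where x: "x \<noteq> 0" "transpose T *v x = 0"
    by (auto simp only: matrix_left_invertible_ker)
  have "orthogonal x c" if c: "c \<in> columns T" for c
  proof -
    from c obtain i where "c = column i T" by (auto simp: columns_def)
    then have "x \<bullet> c = (transpose T *v x) $ i"
      by (simp add: matrix_vector_mul_component row_def column_def inner_vec_def vector_matrix_mult_def mult.commute)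
    then show ?thesis using x(2) by (simp add: orthogonal_def)
  qed
  then have "orthogonal x y" if "y \<in> span (columns T)" for y
    using that orthogonal_to_span by blast
  then show thesis using x(1) by (intro that) (auto simp: orthogonal_comp_def orthogonal_commute)
qed

text \<open>What happens when covariance matrices \<open>S i\<close> degenerate to \<open>T\<close>.  Replacing the part of
  \<open>S i\<close> along the column space \<open>W\<close> of \<open>T\<close> by \<open>s i\<close> times the identity changes no
  expectation, and division by \<open>s i\<close> then leaves a sequence with a positive definite limit.
  The scaling factors tend to zero because \<open>P S P\<close> tends to \<open>P T P = 0\<close> whereas its
  rescaled version tends to \<open>D\<close>, which does not vanish on the complement of \<open>W\<close>, a nonzero
  space since \<open>T\<close> is singular.\<close>

lemma singular_limit_rescaling:
  fixes S :: "nat \<Rightarrow> real^'n^'n" and T D :: "real^'n^'n" and s :: "nat \<Rightarrow> real"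
  defines "W \<equiv> span (columns T)"
  defines "P \<equiv> orth_proj_matrix (orthogonal_comp W)"
  defines "\<Phi> \<equiv> \<lambda>i. (1 / s i) *\<^sub>R (P ** S i ** P) + (mat 1 - P)"
  assumes spd: "\<And>i. sym_pos_def (S i)" and lim: "S \<longlonglongrightarrow> T" and sing: "det T = 0"
    and meas: "\<phi> \<in> borel_measurable borel"
    and inv: "\<forall>x. \<forall>z\<in>W. \<phi> (x + z) = \<phi> x"
    and s: "\<And>i. 0 < s i"
    and D: "(\<lambda>i. (1 / s i) *\<^sub>R (P ** S i ** P)) \<longlonglongrightarrow> D"
    and inj: "inj_on (\<lambda>x. D *v x) (orthogonal_comp W)"
  shows "sym_pos_def (\<Phi> i)"
    and "\<Phi> \<longlonglongrightarrow> D + (mat 1 - P)"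
    and "sym_pos_def (D + (mat 1 - P))"
    and "0 < v \<Longrightarrow> gaussian_expectation \<mu> (v *\<^sub>R S i) \<phi> = gaussian_expectation \<mu> ((v * s i) *\<^sub>R \<Phi> i) \<phi>"
    and "s \<longlonglongrightarrow> 0"
proof -
  let ?L = "orthogonal_comp W"
  have W: "subspace W" by (simp add: W_def)
  have L: "subspace ?L" by (rule subspace_orthogonal_comp)
  have Pv: "P *v x = orth_proj ?L x" for x unfolding P_def by (rule orth_proj_matrix_vector[OF L])
  have scale: "P ** (v *\<^sub>R S i) ** P + (v * s i) *\<^sub>R (mat 1 - P) = (v * s i) *\<^sub>R \<Phi> i" if "0 < v" for v i
  proof -
    have "P ** (v *\<^sub>R S i) ** P = v *\<^sub>R (P ** S i ** P)"
      by (simp add: matrix_scalar_ac scalar_matrix_assoc[symmetric])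
    then show ?thesis using s[of i] by (simp add: \<Phi>_def scaleR_add_right)
  qed
  have spd\<Phi>: "sym_pos_def (\<Phi> i)" for i
  proof -
    have "sym_pos_def ((1 / s i) *\<^sub>R ((1 * s i) *\<^sub>R \<Phi> i))"
      unfolding scale[OF zero_less_one, symmetric] P_def
      using s[of i] by (intro sym_pos_def_scaleR gaussian_expectation_mod_subspace(1)[OF W _ _ meas inv])
        (simp_all add: spd)
    then show ?thesis using s[of i] by simp
  qed
  then show "sym_pos_def (\<Phi> i)" .
  show lim\<Phi>: "\<Phi> \<longlonglongrightarrow> D + (mat 1 - P)"
    unfolding \<Phi>_def by (intro tendsto_intros D)
  show "gaussian_expectation \<mu> (v *\<^sub>R S i) \<phi> = gaussian_expectation \<mu> ((v * s i) *\<^sub>R \<Phi> i) \<phi>" if "0 < v"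
    unfolding scale[OF that, symmetric] P_def
    by (intro gaussian_expectation_mod_subspace(2)[OF W _ _ meas inv] sym_pos_def_scaleR that spd mult_pos_pos s)
  have D_nonneg: "0 \<le> x \<bullet> (D *v x)" for x
  proof -
    have "(\<lambda>i. x \<bullet> (((1 / s i) *\<^sub>R (P ** S i ** P)) *v x)) \<longlonglongrightarrow> x \<bullet> (D *v x)"
      by (intro tendsto_inner tendsto_matrix_vector D tendsto_const)
    moreover have "0 \<le> x \<bullet> (((1 / s i) *\<^sub>R (P ** S i ** P)) *v x)" for i
    proof -
      have "x \<bullet> ((P ** S i ** P) *v x) = (P *v x) \<bullet> (S i *v (P *v x))"
        using inner_matrix_vector_transpose[of x P "S i *v (P *v x)"]
        by (simp only: matrix_vector_mul_assoc[symmetric] P_def transpose_orth_proj_matrix[OF L])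
      moreover have "0 \<le> (P *v x) \<bullet> (S i *v (P *v x))"
        using spd[of i] by (cases "P *v x = 0") (auto simp: sym_pos_def_def less_imp_le)
      ultimately show ?thesis using s[of i] by (simp add: scaleR_matrix_vector_assoc[symmetric] less_imp_le)
    qed
    ultimately show ?thesis by (intro LIMSEQ_le_const) auto
  qed
  have D_sym: "transpose D = D"
  proof -
    have "transpose (D + (mat 1 - P)) = D + (mat 1 - P)" by (rule psd_limit(1)[OF lim\<Phi> spd\<Phi>])
    moreover have "transpose (mat 1 - P) = mat 1 - P"
      using transpose_orth_proj_matrix[OF L, folded P_def] by (simp add: transpose_def vec_eq_iff mat_def)
    ultimately show ?thesis by (simp add: transpose_add)
  qed
  show "sym_pos_def (D + (mat 1 - P))"
    unfolding sym_pos_def_def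
  proof (intro conjI allI impI)
    show "transpose (D + (mat 1 - P)) = D + (mat 1 - P)" by (rule psd_limit(1)[OF lim\<Phi> spd\<Phi>])
    fix x :: "real^'n" assume "x \<noteq> 0"
    have P2: "x \<bullet> ((mat 1 - P) *v x) = (x - P *v x) \<bullet> (x - P *v x)"
    proof -
      have "(P *v x) \<bullet> (x - P *v x) = 0"
        unfolding Pv by (rule orthogonal_comp_inner[OF orth_proj_mem[OF L]])
      then show ?thesis by (simp add: matrix_vector_mult_diff_rdistrib inner_diff_left inner_diff_right)
    qed
    have "x \<bullet> (D *v x) + (x - P *v x) \<bullet> (x - P *v x) \<noteq> 0"
    proof
      assume eq: "x \<bullet> (D *v x) + (x - P *v x) \<bullet> (x - P *v x) = 0"
      then have "x \<bullet> (D *v x) = 0" "(x - P *v x) \<bullet> (x - P *v x) = 0"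
        using D_nonneg[of x] inner_ge_zero[of "x - P *v x"] by linarith+
      then have "D *v x = 0" "x = P *v x"
        using psd_null_vector[OF D_sym D_nonneg] by auto
      then have "x \<in> ?L" using orth_proj_mem(1)[OF L, of x] by (simp add: Pv)
      then have "x = 0"
        using inj_onD[OF inj, of x 0] \<open>D *v x = 0\<close> subspace_0[OF L] by simp
      then show False using \<open>x \<noteq> 0\<close> by simp
    qed
    then show "0 < x \<bullet> ((D + (mat 1 - P)) *v x)"
      using D_nonneg[of x] inner_ge_zero[of "x - P *v x"] P2
      by (simp add: matrix_vector_mult_add_rdistrib inner_add_right del: inner_ge_zero)
  qed
  show "s \<longlonglongrightarrow> 0"
  proof -
    obtain x where x: "x \<noteq> 0" "x \<in> ?L"
      using singular_orthogonal_vector[OF sing] unfolding W_def by blast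
    define y where "y i = ((1 / s i) *\<^sub>R (P ** S i ** P)) *v x" for i
    have y: "y \<longlonglongrightarrow> D *v x"
      unfolding y_def by (intro tendsto_matrix_vector D tendsto_const)
    have Dx: "D *v x \<noteq> 0"
      using inj_onD[OF inj, of x 0] x subspace_0[OF L] by auto
    have "(\<lambda>i. (P ** S i ** P) *v x) \<longlonglongrightarrow> (P ** T ** P) *v x"
      by (intro tendsto_matrix_vector tendsto_matrix_mult lim tendsto_const)
    also have "(P ** T ** P) *v x = P *v (T *v (P *v x))"
      by (simp add: matrix_vector_mul_assoc[symmetric])
    also have "\<dots> = 0"
      unfolding Pv orth_proj_comp_zero_iff[OF W] unfolding W_def by (rule matrix_vector_mult_in_columnspace)
    finally have "(\<lambda>i. norm ((P ** S i ** P) *v x) / norm (y i)) \<longlonglongrightarrow> norm (0::real^'n) / norm (D *v x)"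
      using Dx by (intro tendsto_intros y) auto
    moreover have "\<forall>\<^sub>F i in sequentially. norm ((P ** S i ** P) *v x) / norm (y i) = s i"
    proof -
      have "\<forall>\<^sub>F i in sequentially. y i \<noteq> 0" using y Dx by (rule tendsto_imp_eventually_ne)
      then show ?thesis
      proof eventually_elim
        case (elim i)
        have "(P ** S i ** P) *v x = s i *\<^sub>R y i"
          using s[of i] by (simp add: y_def scaleR_matrix_vector_assoc[symmetric])
        then show ?case using elim s[of i] by simp
      qed
    qed
    ultimately show ?thesis by (simp add: tendsto_cong)
  qed
qed

text \<open>Compactness up to rescaling.  A bounded sequence in the model has a convergent subsequence; if its
  limit is regular nothing needs to be done and the factors \<open>s\<close> are one, otherwise the preceding
  lemma applies along a further subsequence.  The scale \<open>v\<close> in the equation is free, so that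
  \<open>s\<close> can later be absorbed into the variance parameter.\<close>

lemma model_subsequence:
  fixes C :: "(real^'n^'n) set" and S :: "nat \<Rightarrow> real^'n^'n"
  assumes C: "covariance_model C" and bnd: "bounded C"
    and inv: "\<forall>x. \<forall>z\<in>concentration_set C. \<phi> (x + z) = \<phi> x"
    and reg: "regular_rescaling C"
    and meas: "\<phi> \<in> borel_measurable borel"
    and S: "\<And>m. S m \<in> C"
  obtains h s \<Phi> \<Psi> where "strict_mono (h :: nat \<Rightarrow> nat)" "\<And>i. (0::real) < s i" "\<And>i. sym_pos_def (\<Phi> i)"
    "\<Phi> \<longlonglongrightarrow> \<Psi>" "sym_pos_def \<Psi>"
    "\<And>i \<mu> v. 0 < v \<Longrightarrow>
       gaussian_expectation \<mu> (v *\<^sub>R S (h i)) \<phi> = gaussian_expectation \<mu> ((v * s i) *\<^sub>R \<Phi> i) \<phi>"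
    "\<And>T. S \<longlonglongrightarrow> T \<Longrightarrow> det T = 0 \<Longrightarrow> s \<longlonglongrightarrow> 0"
proof -
  have spd: "sym_pos_def (S m)" for m using C S by (auto simp: covariance_model_def)
  have "compact (closure C)" using bnd by simp
  moreover have "\<forall>m. S m \<in> closure C" using S closure_subset by blast
  ultimately have "\<exists>T\<in>closure C. \<exists>k. strict_mono (k :: nat \<Rightarrow> nat) \<and> (S \<circ> k) \<longlonglongrightarrow> T"
    unfolding compact_def by (elim allE[of _ S]) (rule mp)
  then obtain T k where k: "strict_mono (k :: nat \<Rightarrow> nat)" "(S \<circ> k) \<longlonglongrightarrow> T"
    by meson
  show thesis
  proof (cases "det T = 0")
    case False
    have T: "sym_pos_def T"
      by (rule nonsingular_limit_sym_pos_def[OF k(2) _ False]) (simp add: spd)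
    have T': "(\<lambda>_::nat. 1::real) \<longlonglongrightarrow> 0" if T': "S \<longlonglongrightarrow> T'" "det T' = 0" for T'
    proof -
      have "T' = T" by (rule LIMSEQ_unique[OF LIMSEQ_subseq_LIMSEQ[OF T'(1) k(1)] k(2)])
      then show ?thesis using False T'(2) by simp
    qed
    show thesis
    proof (rule that[of k "\<lambda>_. 1" "S \<circ> k" T])
      show "(\<lambda>_::nat. 1::real) \<longlonglongrightarrow> 0" if "S \<longlonglongrightarrow> T'" "det T' = 0" for T'
        using that by (rule T')
    qed (simp_all add: k T spd)
  next
    case True
    define W where "W = span (columns T)"
    define P where "P = orth_proj_matrix (orthogonal_comp W)"
    have SC: "(\<forall>m. (S \<circ> k) m \<in> C) \<and> (S \<circ> k) \<longlonglongrightarrow> T \<and> det T = 0" using S k(2) True by simp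
    obtain h s D where h: "strict_mono (h :: nat \<Rightarrow> nat)" "\<And>i. (0::real) < s (h i)"
      "(\<lambda>i. (1 / s (h i)) *\<^sub>R (P ** (S \<circ> k) (h i) ** P)) \<longlonglongrightarrow> D"
      "inj_on (\<lambda>x. D *v x) (orthogonal_comp W)"
      using reg[unfolded regular_rescaling_def Let_def, rule_format, OF SC]
      unfolding P_def W_def by blast
    have "W \<subseteq> concentration_set C"
      unfolding concentration_set_def W_def using SC by blast
    then have invW: "\<forall>x. \<forall>z\<in>W. \<phi> (x + z) = \<phi> x" using inv by blast
    have lim: "(\<lambda>i. S (k (h i))) \<longlonglongrightarrow> T"
      using LIMSEQ_subseq_LIMSEQ[OF k(2) h(1)] by (simp add: o_def)
    note * = singular_limit_rescaling[where S = "\<lambda>i. S (k (h i))" and T = T and s = "\<lambda>i. s (h i)" and D = D and \<phi> = \<phi>,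
        folded W_def, folded P_def, OF spd lim True meas invW h(2) h(3)[unfolded o_def] h(4)]
    have kh: "strict_mono (k \<circ> h)" using k(1) h(1) by (rule strict_mono_o)
    show thesis
    proof (rule that[OF kh h(2) *(1) *(2) *(3)])
      show "(\<lambda>i. s (h i)) \<longlonglongrightarrow> 0" by (rule *(5))
      show "gaussian_expectation \<mu> (v *\<^sub>R S ((k \<circ> h) i)) \<phi> = gaussian_expectation \<mu> ((v * s (h i)) *\<^sub>R
          ((1 / s (h i)) *\<^sub>R (P ** S (k (h i)) ** P) + (mat 1 - P))) \<phi>" if "0 < v" for i \<mu> v
        unfolding o_def using that by (rule *(4))
    qed
  qed
qed

section \<open>Convergence along subsequences\<close>

text \<open>An infimum that stays below one along a subsequence is nearly attained there; the near minimizers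
  \<open>p\<close> give a sequence of points against which the hypothesis can be tested.  In this way statements
  about infima reduce to statements about sequences.\<close>

lemma INF_tendsto_one:
  fixes E :: "nat \<Rightarrow> 'p \<Rightarrow> real"
  assumes ne: "\<And>m. A m \<noteq> {}" and bnd: "\<And>m p. p \<in> A m \<Longrightarrow> 0 \<le> E m p \<and> E m p \<le> 1"
    and sub: "\<And>k p. strict_mono (k :: nat \<Rightarrow> nat) \<Longrightarrow> (\<And>i. p i \<in> A (k i)) \<Longrightarrow>
      \<exists>h. strict_mono (h :: nat \<Rightarrow> nat) \<and> (\<lambda>i. E (k (h i)) (p (h i))) \<longlonglongrightarrow> 1"
  shows "(\<lambda>m. INF p\<in>A m. E m p) \<longlonglongrightarrow> 1"
proof -
  have bdd: "bdd_below (E m ` A m)" for m using bnd by (intro bdd_belowI[of _ 0]) auto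
  have le1: "(INF p\<in>A m. E m p) \<le> 1" for m
  proof -
    obtain p where p: "p \<in> A m" using ne by blast
    have "(INF p\<in>A m. E m p) \<le> E m p" by (rule cINF_lower[OF bdd p])
    also have "\<dots> \<le> 1" using bnd[OF p] by simp
    finally show ?thesis .
  qed
  have ev: "\<forall>\<^sub>F m in sequentially. b < (INF p\<in>A m. E m p)" if b: "b < 1" for b
  proof (rule ccontr)
    assume "\<not> ?thesis"
    from not_eventually_sequentiallyD[OF this]
    obtain k where k: "strict_mono (k :: nat \<Rightarrow> nat)" "\<And>i. (INF p\<in>A (k i). E (k i) p) \<le> b"
      unfolding not_less by (elim exE conjE) blast
    define b' where "b' = (b + 1) / 2"
    have b': "b < b'" "b' < 1" using b by (simp_all add: b'_def)
    have "\<exists>p. p \<in> A (k i) \<and> E (k i) p < b'" for i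
      using cINF_less_iff[OF ne bdd, of "k i" b'] k(2)[of i] b'(1) by auto
    then obtain p where p: "\<And>i. p i \<in> A (k i)" "\<And>i. E (k i) (p i) < b'" by metis
    obtain h where h: "strict_mono (h :: nat \<Rightarrow> nat)" "(\<lambda>i. E (k (h i)) (p (h i))) \<longlonglongrightarrow> 1"
      using sub[OF k(1) p(1)] by blast
    have "1 \<le> b'"
      using p(2) by (intro LIMSEQ_le_const2[OF h(2)]) (auto intro: less_imp_le)
    then show False using b'(2) by simp
  qed
  show ?thesis
  proof (rule order_tendstoI)
    show "\<forall>\<^sub>F m in sequentially. b < (INF p\<in>A m. E m p)" if "b < 1" for b by (rule ev[OF that])
    show "\<forall>\<^sub>F m in sequentially. (INF p\<in>A m. E m p) < b" if "1 < b" for b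
      using le1 that by (intro always_eventually allI) (rule le_less_trans)
  qed
qed

lemma tendsto_one_of_liminf:
  fixes f :: "nat \<Rightarrow> real"
  assumes "liminf (\<lambda>m. ereal (f m)) = 1" "\<And>m. f m \<le> 1"
  shows "f \<longlonglongrightarrow> 1"
proof -
  have "limsup (\<lambda>m. ereal (f m)) \<le> 1"
    unfolding one_ereal_def using assms(2)
    by (intro Limsup_bounded always_eventually allI) (simp only: ereal_less_eq)
  moreover have "1 \<le> limsup (\<lambda>m. ereal (f m))"
    using Liminf_le_Limsup[of sequentially "\<lambda>m. ereal (f m)"] assms(1) by simp
  ultimately have "limsup (\<lambda>m. ereal (f m)) = 1" by (rule antisym)
  then have "(\<lambda>m. ereal (f m)) \<longlonglongrightarrow> 1"
    using assms(1) by (simp add: tendsto_iff_Liminf_eq_Limsup)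
  then show ?thesis by (simp only: one_ereal_def lim_ereal)
qed

lemma bounded_subsequence_or_diverges:
  fixes x :: "nat \<Rightarrow> 'a::euclidean_space"
  assumes "\<not> filterlim (\<lambda>m. norm (x m)) at_top sequentially"
  obtains k l where "strict_mono (k :: nat \<Rightarrow> nat)" "(\<lambda>i. x (k i)) \<longlonglongrightarrow> l"
proof -
  obtain B where B: "\<not> (\<forall>\<^sub>F m in sequentially. B \<le> norm (x m))"
    using assms by (auto simp: filterlim_at_top)
  then obtain k where k: "strict_mono (k :: nat \<Rightarrow> nat)" "\<And>i. \<not> B \<le> norm (x (k i))"
    using not_eventually_sequentiallyD by blast
  have "bounded (range (\<lambda>i. x (k i)))"
    using k(2) by (intro boundedI[of _ B]) (auto simp: not_le less_imp_le)
  then obtain l k' where k': "strict_mono (k' :: nat \<Rightarrow> nat)" "((\<lambda>i. x (k i)) \<circ> k') \<longlonglongrightarrow> l"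
    using bounded_imp_convergent_subsequence by metis
  show thesis
    by (rule that[OF strict_mono_o[OF k(1) k'(1)], of l]) (use k'(2) in \<open>simp add: o_def\<close>)
qed

section \<open>Testing an affine subspace inside a linear space\<close>

text \<open>The linear algebra of the null hypothesis: \<open>M0\<close> is a translate of the linear space \<open>N\<close> by
  any of its points, inside the space \<open>V\<close> of all means.\<close>

locale invariant_testing_problem =
  fixes V N M0 :: "(real^'n) set" and \<phi> :: "real^'n \<Rightarrow> real"
  assumes V: "subspace V" and N: "subspace N"
    and M0_sub: "M0 \<subseteq> V" and M0_ne: "M0 \<noteq> {}" and M1_ne: "V - M0 \<noteq> {}"
    and M0_translate: "\<And>\<mu>. \<mu> \<in> M0 \<Longrightarrow> (\<lambda>x. x - \<mu>) ` M0 = N"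
    and meas: "\<phi> \<in> borel_measurable borel"
    and range: "\<And>x. 0 \<le> \<phi> x \<and> \<phi> x \<le> 1"
    and inv: "almost_invariant (invariance_group M0) \<phi>"
    and not1: "\<not> (AE x in lborel. \<phi> x = 1)" and not0: "\<not> (AE x in lborel. \<phi> x = 0)"
begin

abbreviation "M1 \<equiv> V - M0"
abbreviation "E \<mu> \<Phi> \<equiv> gaussian_expectation \<mu> \<Phi> \<phi>"
text \<open>The projection whose value at \<open>\<mu> - \<mu>0\<close> measures the deviation of \<open>\<mu>\<close> from \<open>M0\<close>.\<close>

abbreviation "proj \<equiv> orth_proj (orthogonal_comp N)"

lemma linear_proj: "linear proj"
  by (rule linear_orth_proj[OF subspace_orthogonal_comp])

lemma mem_M0_iff: "\<mu>0 \<in> M0 \<Longrightarrow> \<mu> \<in> M0 \<longleftrightarrow> \<mu> - \<mu>0 \<in> N"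
  using M0_translate[of \<mu>0] by (force simp: image_iff)

lemma proj_base_point: "\<mu>0 \<in> M0 \<Longrightarrow> \<mu>0' \<in> M0 \<Longrightarrow> proj (\<mu> - \<mu>0) = proj (\<mu> - \<mu>0')"
proof -
  assume m: "\<mu>0 \<in> M0" "\<mu>0' \<in> M0"
  have "proj (\<mu>0' - \<mu>0) = 0" using m by (simp add: orth_proj_comp_zero_iff[OF N] mem_M0_iff[symmetric])
  then have "proj ((\<mu> - \<mu>0') + (\<mu>0' - \<mu>0)) = proj (\<mu> - \<mu>0')" by (simp only: linear_add[OF linear_proj] add_0_right)
  then show ?thesis by simp
qed

lemma infdist_M0:
  assumes "\<mu>0 \<in> M0"
  shows "infdist \<mu> M0 = norm (proj (\<mu> - \<mu>0))"
proof (rule antisym)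
  have "(\<mu> - proj (\<mu> - \<mu>0)) - \<mu>0 \<in> N"
    using orth_proj_comp_mem[OF N, of "\<mu> - \<mu>0"] by (simp add: algebra_simps)
  then have "\<mu> - proj (\<mu> - \<mu>0) \<in> M0" by (simp only: mem_M0_iff[OF assms])
  then show "infdist \<mu> M0 \<le> norm (proj (\<mu> - \<mu>0))"
    using infdist_le[of "\<mu> - proj (\<mu> - \<mu>0)" M0 \<mu>] by (simp add: dist_norm)
  have "norm (proj (\<mu> - \<mu>0)) \<le> dist \<mu> y" if "y \<in> M0" for y
    using proj_base_point[OF assms that] norm_orth_proj_le[OF subspace_orthogonal_comp, of N "\<mu> - y"]
    by (simp add: dist_norm)
  then show "norm (proj (\<mu> - \<mu>0)) \<le> infdist \<mu> M0"
    unfolding infdist_notempty[OF M0_ne] by (intro cINF_greatest M0_ne)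
qed

lemma scale_M1:
  assumes "\<mu>0 \<in> M0" "\<mu> \<in> M1" "c \<noteq> 0"
  shows "c *\<^sub>R (\<mu> - \<mu>0) + \<mu>0 \<in> M1"
proof -
  have "c *\<^sub>R (\<mu> - \<mu>0) \<notin> N"
  proof
    assume "c *\<^sub>R (\<mu> - \<mu>0) \<in> N"
    then have "(1 / c) *\<^sub>R (c *\<^sub>R (\<mu> - \<mu>0)) \<in> N" by (rule subspace_scale[OF N])
    then show False using assms by (simp add: mem_M0_iff[OF assms(1)])
  qed
  then have "c *\<^sub>R (\<mu> - \<mu>0) + \<mu>0 \<notin> M0" by (simp add: mem_M0_iff[OF assms(1)])
  moreover have "c *\<^sub>R (\<mu> - \<mu>0) + \<mu>0 \<in> V"
    using assms M0_sub V by (intro subspace_add subspace_scale subspace_diff) auto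
  ultimately show ?thesis by simp
qed

lemma proj_nonzero: "\<mu>0 \<in> M0 \<Longrightarrow> \<mu> \<in> M1 \<Longrightarrow> proj (\<mu> - \<mu>0) \<noteq> 0"
  by (simp add: orth_proj_comp_zero_iff[OF N] mem_M0_iff[symmetric])

text \<open>The map \<open>y \<mapsto> (y - a) / \<surd>w + \<mu>0\<close>, with \<open>a\<close> the point of \<open>M0\<close> nearest to \<open>\<mu>\<close>, belongs to
  the invariance group.  It removes the scale \<open>w\<close> and the part of the mean along \<open>N\<close>, so that only
  the standardized deviation from \<open>M0\<close> is left; its norm is the distance to \<open>M0\<close> divided by
  \<open>\<surd>w\<close>.\<close>

lemma expectation_reduction:
  assumes \<mu>0: "\<mu>0 \<in> M0" and w: "0 < w" and spd: "sym_pos_def \<Phi>"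
  shows "E \<mu> (w *\<^sub>R \<Phi>) = E ((1 / sqrt w) *\<^sub>R proj (\<mu> - \<mu>0) + \<mu>0) \<Phi>"
proof -
  define a where "a = \<mu> - proj (\<mu> - \<mu>0)"
  have "a - \<mu>0 \<in> N" using orth_proj_comp_mem[OF N, of "\<mu> - \<mu>0"] by (simp add: a_def algebra_simps)
  then have a: "a \<in> M0" by (simp add: mem_M0_iff[OF \<mu>0])
  have "E ((1 / sqrt w) *\<^sub>R (\<mu> - a) + \<mu>0) ((1 / sqrt w)\<^sup>2 *\<^sub>R (w *\<^sub>R \<Phi>)) = E \<mu> (w *\<^sub>R \<Phi>)"
    using w by (intro almost_invariant_expectation[OF inv meas a \<mu>0] sym_pos_def_scaleR spd) auto
  moreover have "(1 / sqrt w)\<^sup>2 *\<^sub>R (w *\<^sub>R \<Phi>) = \<Phi>" using w by (simp add: power_divide)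
  moreover have "\<mu> - a = proj (\<mu> - \<mu>0)" by (simp add: a_def)
  ultimately show ?thesis by simp
qed

lemma expectation_null:
  assumes "\<mu>0 \<in> M0" "\<mu> \<in> M0" "0 < w" "sym_pos_def \<Phi>"
  shows "E \<mu> (w *\<^sub>R \<Phi>) = E \<mu>0 \<Phi>"
  using assms expectation_reduction[of \<mu>0 w \<Phi> \<mu>] orth_proj_comp_zero_iff[OF N, of "\<mu> - \<mu>0"]
  by (simp add: mem_M0_iff[symmetric])

text \<open>Standardized deviations are again projections of differences to alternative means, because
  scaling about \<open>\<mu>0\<close> by a nonzero factor maps the alternative to itself.\<close>

lemma diverging_meansI:
  assumes \<mu>0: "\<mu>0 \<in> M0" and "\<And>m. \<mu> m \<in> M1" "\<And>m. c m \<noteq> 0"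
    and "filterlim (\<lambda>m. norm (c m *\<^sub>R proj (\<mu> m - \<mu>0))) at_top sequentially"
    and "\<And>m. sym_pos_def (\<Phi> m)" "\<Phi> \<longlonglongrightarrow> \<Psi>" "sym_pos_def \<Psi>"
  shows "diverging_means M0 M1 \<mu>0 (\<lambda>m. c m *\<^sub>R proj (\<mu> m - \<mu>0)) \<Phi>"
proof -
  have "c m *\<^sub>R proj (\<mu> m - \<mu>0) \<in> proj ` (\<lambda>x. x - \<mu>0) ` M1" for m
  proof (rule image_eqI)
    show "c m *\<^sub>R proj (\<mu> m - \<mu>0) = proj (c m *\<^sub>R (\<mu> m - \<mu>0))"
      by (simp only: linear_scale[OF linear_proj])
    have "c m *\<^sub>R (\<mu> m - \<mu>0) + \<mu>0 \<in> M1" by (rule scale_M1) (use assms in auto)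
    then show "c m *\<^sub>R (\<mu> m - \<mu>0) \<in> (\<lambda>x. x - \<mu>0) ` M1"
      by (rule rev_image_eqI) simp
  qed
  then show ?thesis
    unfolding diverging_means_def M0_translate[OF \<mu>0] using assms by blast
qed

text \<open>The translation by \<open>\<mu>0' - \<mu>0\<close> belongs to the invariance group and leaves projected differences
  unchanged.\<close>

lemma liminf_positive_base_point:
  assumes \<mu>0: "\<mu>0 \<in> M0" "\<mu>0' \<in> M0" and pos: "liminf_positive M0 M1 \<phi> \<mu>0"
  shows "liminf_positive M0 M1 \<phi> \<mu>0'"
  unfolding liminf_positive_def
proof (intro allI impI)
  fix \<nu> \<Phi> assume div: "diverging_means M0 M1 \<mu>0' \<nu> \<Phi>"
  have "proj ` (\<lambda>x. x - \<mu>0) ` M1 = proj ` (\<lambda>x. x - \<mu>0') ` M1"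
    by (simp only: image_image proj_base_point[OF \<mu>0])
  then have "diverging_means M0 M1 \<mu>0 \<nu> \<Phi>"
    using div unfolding diverging_means_def M0_translate[OF \<mu>0(1)] M0_translate[OF \<mu>0(2)] by simp
  then have "0 < liminf (\<lambda>m. ereal (E (\<nu> m + \<mu>0) (\<Phi> m)))"
    using pos by (simp add: liminf_positive_def)
  moreover have "E (\<nu> m + \<mu>0) (\<Phi> m) = E (\<nu> m + \<mu>0') (\<Phi> m)" for m
  proof -
    have "sym_pos_def (\<Phi> m)" using div by (simp add: diverging_means_def)
    then show ?thesis
      using almost_invariant_expectation[OF inv meas \<mu>0, of 1 "\<Phi> m" "\<nu> m + \<mu>0"] by simp
  qed
  ultimately show "0 < liminf (\<lambda>m. ereal (E (\<nu> m + \<mu>0') (\<Phi> m)))" by simp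
qed

lemma liminf_one_tendsto:
  assumes one: "liminf_one M0 M1 \<phi> \<mu>0" and div: "diverging_means M0 M1 \<mu>0 \<nu> \<Phi>"
  shows "(\<lambda>m. E (\<nu> m + \<mu>0) (\<Phi> m)) \<longlonglongrightarrow> 1"
proof (rule tendsto_one_of_liminf)
  show "liminf (\<lambda>m. ereal (E (\<nu> m + \<mu>0) (\<Phi> m))) = 1"
    using one div by (simp add: liminf_one_def)
  show "E (\<nu> m + \<mu>0) (\<Phi> m) \<le> 1" for m
    using div by (intro gaussian_expectation_bounds meas range) (simp add: diverging_means_def)
qed

text \<open>The infima below are taken over sets of alternatives far from \<open>M0\<close>; nonemptiness makes them
  genuine infima of real numbers.\<close>

lemma alternatives_ne: "\<exists>\<mu>\<in>M1. d \<le> infdist \<mu> M0"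
proof -
  obtain \<mu>0 \<mu> where m: "\<mu>0 \<in> M0" "\<mu> \<in> M1" using M0_ne M1_ne by blast
  define t where "t = (\<bar>d\<bar> + 1) / norm (proj (\<mu> - \<mu>0))"
  have n: "0 < norm (proj (\<mu> - \<mu>0))" using proj_nonzero[OF m] by simp
  have "0 < t" using n unfolding t_def by (intro divide_pos_pos) auto
  then have "t *\<^sub>R (\<mu> - \<mu>0) + \<mu>0 \<in> M1" by (intro scale_M1 m) simp
  moreover have "infdist (t *\<^sub>R (\<mu> - \<mu>0) + \<mu>0) M0 = \<bar>d\<bar> + 1"
    using n \<open>0 < t\<close> by (simp add: infdist_M0[OF m(1)] linear_scale[OF linear_proj] t_def)
  ultimately show ?thesis by (intro bexI[of _ "t *\<^sub>R (\<mu> - \<mu>0) + \<mu>0"]) auto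
qed

text \<open>Standardizing turns the means into a sequence of deviations of norm at least \<open>c m / \<surd>(v m)\<close>,
  with covariance matrices that already converge to a positive definite limit.\<close>

lemma power_tends_to_one_regular_limit:
  assumes \<mu>0: "\<mu>0 \<in> M0" and one: "liminf_one M0 M1 \<phi> \<mu>0"
    and v: "\<And>m. 0 < v m" and cv: "filterlim (\<lambda>m. c m / sqrt (v m)) at_top sequentially"
    and S: "\<And>m. sym_pos_def (S m)" "S \<longlonglongrightarrow> T" "sym_pos_def T"
  shows "(\<lambda>m. INF \<mu> \<in> {\<mu> \<in> M1. c m \<le> infdist \<mu> M0}. E \<mu> (v m *\<^sub>R S m)) \<longlonglongrightarrow> 1"
proof (rule INF_tendsto_one)
  show "{\<mu> \<in> M1. c m \<le> infdist \<mu> M0} \<noteq> {}" for m using alternatives_ne by blast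
  show "0 \<le> E \<mu> (v m *\<^sub>R S m) \<and> E \<mu> (v m *\<^sub>R S m) \<le> 1" for m \<mu>
    by (intro conjI gaussian_expectation_bounds meas range sym_pos_def_scaleR v S)
next
  fix k :: "nat \<Rightarrow> nat" and p
  assume k: "strict_mono k" and p: "\<And>i. p i \<in> {\<mu> \<in> M1. c (k i) \<le> infdist \<mu> M0}"
  define \<nu> where "\<nu> i = (1 / sqrt (v (k i))) *\<^sub>R proj (p i - \<mu>0)" for i
  have sv: "0 < sqrt (v m)" for m using v by simp
  have "diverging_means M0 M1 \<mu>0 \<nu> (\<lambda>i. S (k i))"
    unfolding \<nu>_def
  proof (rule diverging_meansI[OF \<mu>0])
    have cvk: "filterlim (\<lambda>i. c (k i) / sqrt (v (k i))) at_top sequentially"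
      using filterlim_compose[OF cv filterlim_subseq[OF k]] by simp
    show "filterlim (\<lambda>i. norm ((1 / sqrt (v (k i))) *\<^sub>R proj (p i - \<mu>0))) at_top sequentially"
    proof (rule filterlim_at_top_mono[OF cvk], intro always_eventually allI)
      fix i
      have "c (k i) / sqrt (v (k i)) \<le> norm (proj (p i - \<mu>0)) / sqrt (v (k i))"
        using p[of i] sv[of "k i"] by (intro divide_right_mono) (auto simp: infdist_M0[OF \<mu>0])
      then show "c (k i) / sqrt (v (k i)) \<le> norm ((1 / sqrt (v (k i))) *\<^sub>R proj (p i - \<mu>0))"
        using sv[of "k i"] by simp
    qed
    show "(\<lambda>i. S (k i)) \<longlonglongrightarrow> T" using LIMSEQ_subseq_LIMSEQ[OF S(2) k] by (simp add: o_def)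
    show "p i \<in> M1" "1 / sqrt (v (k i)) \<noteq> 0" for i using p[of i] sv[of "k i"] by auto
  qed (rule S)+
  then have "(\<lambda>i. E (\<nu> i + \<mu>0) (S (k i))) \<longlonglongrightarrow> 1" by (rule liminf_one_tendsto[OF one])
  then have "(\<lambda>i. E (p i) (v (k i) *\<^sub>R S (k i))) \<longlonglongrightarrow> 1"
    by (simp only: \<nu>_def expectation_reduction[OF \<mu>0 v S(1)])
  then show "\<exists>h. strict_mono (h :: nat \<Rightarrow> nat) \<and> (\<lambda>i. E (p (h i)) (v (k (h i)) *\<^sub>R S (k (h i)))) \<longlonglongrightarrow> 1"
    by (intro exI[of _ id]) (simp add: strict_mono_def)
qed

end

locale concentrating_testing_problem = invariant_testing_problem V N M0 \<phi>
  for V N M0 :: "(real^'n) set" and \<phi> +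
  fixes C :: "(real^'n^'n) set"
  assumes C: "covariance_model C" and bnd: "bounded C"
    and invJ: "\<forall>x. \<forall>z\<in>concentration_set C. \<phi> (x + z) = \<phi> x"
    and reg: "regular_rescaling C"
begin

lemma C_spd: "S \<in> C \<Longrightarrow> sym_pos_def S" and C_ne: "C \<noteq> {}"
  using C by (auto simp: covariance_model_def)

lemma expectation_bounds: "S \<in> C \<Longrightarrow> 0 < v \<Longrightarrow> 0 \<le> E \<mu> (v *\<^sub>R S) \<and> E \<mu> (v *\<^sub>R S) \<le> 1"
  by (intro conjI gaussian_expectation_bounds meas range sym_pos_def_scaleR C_spd)

text \<open>Under the null hypothesis the standardized deviation is zero, so the rescaling factors disappear
  altogether and continuity identifies the limit.\<close>

lemma null_expectation_limit:
  assumes \<mu>0: "\<mu>0 \<in> M0" and S: "\<And>m. S m \<in> C"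
  obtains h \<Psi> where "strict_mono (h :: nat \<Rightarrow> nat)" "sym_pos_def \<Psi>" "(\<lambda>i. E \<mu>0 (S (h i))) \<longlonglongrightarrow> E \<mu>0 \<Psi>"
proof -
  obtain h s \<Phi> \<Psi> where *: "strict_mono (h :: nat \<Rightarrow> nat)" "\<And>i. (0::real) < s i" "\<And>i. sym_pos_def (\<Phi> i)"
    "\<Phi> \<longlonglongrightarrow> \<Psi>" "sym_pos_def \<Psi>"
    "\<And>i \<mu> v. 0 < v \<Longrightarrow> E \<mu> (v *\<^sub>R S (h i)) = E \<mu> ((v * s i) *\<^sub>R \<Phi> i)"
    "\<And>T. S \<longlonglongrightarrow> T \<Longrightarrow> det T = 0 \<Longrightarrow> s \<longlonglongrightarrow> 0"
    by (rule model_subsequence[OF C bnd invJ reg meas S]) (rule that)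
  have "E \<mu>0 (S (h i)) = E \<mu>0 (\<Phi> i)" for i
    using *(6)[of 1 \<mu>0 i] expectation_null[OF \<mu>0 \<mu>0 *(2,3)] by simp
  moreover have "(\<lambda>i. E \<mu>0 (\<Phi> i)) \<longlonglongrightarrow> E \<mu>0 \<Psi>"
    by (intro gaussian_expectation_tendsto meas range tendsto_const *)
  ultimately show thesis using that *(1,5) by simp
qed

text \<open>Otherwise a sequence in the model has null expectations tending to one, and by the preceding lemma
  the expectation is one for some regular covariance matrix; this forces the test to be one almost
  everywhere.\<close>

lemma size_less_one:
  obtains b where "b < 1" "\<And>\<mu> v S. \<mu> \<in> M0 \<Longrightarrow> 0 < v \<Longrightarrow> S \<in> C \<Longrightarrow> E \<mu> (v *\<^sub>R S) \<le> b"
proof -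
  obtain \<mu>0 where \<mu>0: "\<mu>0 \<in> M0" using M0_ne by blast
  have "\<exists>b<1. \<forall>S\<in>C. E \<mu>0 S \<le> b"
  proof (rule ccontr)
    assume "\<not> ?thesis"
    then have "\<exists>S\<in>C. 1 - 1 / Suc m < E \<mu>0 S" for m :: nat
      by (simp add: not_le)
    then obtain S where S: "\<And>m. S m \<in> C" "\<And>m. 1 - 1 / Suc m < E \<mu>0 (S m)" by metis
    obtain h \<Psi> where h: "strict_mono (h :: nat \<Rightarrow> nat)" "sym_pos_def \<Psi>" "(\<lambda>i. E \<mu>0 (S (h i))) \<longlonglongrightarrow> E \<mu>0 \<Psi>"
      by (rule null_expectation_limit[of \<mu>0 S, OF \<mu>0 S(1)]) (rule that)
    have "(\<lambda>m. 1 - 1 / real (Suc m)) \<longlonglongrightarrow> 1 - 0"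
      by (intro tendsto_intros LIMSEQ_Suc[OF lim_1_over_n])
    then have "(\<lambda>i. 1 - 1 / real (Suc (h i))) \<longlonglongrightarrow> 1"
      using LIMSEQ_subseq_LIMSEQ[OF _ h(1)] by (fastforce simp: o_def)
    then have "1 \<le> E \<mu>0 \<Psi>"
      using S(2) by (intro LIMSEQ_le[OF _ h(3)]) (auto intro: less_imp_le)
    then show False using gaussian_expectation_less_one[OF h(2) meas range not1, of \<mu>0] by simp
  qed
  then obtain b where "b < 1" "\<forall>S\<in>C. E \<mu>0 S \<le> b" by blast
  then show thesis using that[of b] expectation_null[OF \<mu>0] C_spd by simp
qed

text \<open>Along a sequence with power tending to zero, the standardized deviations either have a bounded
  subsequence, and continuity yields power zero for some regular covariance matrix, or their norms
  diverge, and the hypothesis on the limit inferior is contradicted.\<close>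

lemma power_positive_from_liminf:
  assumes \<mu>0: "\<mu>0 \<in> M0" and pos: "liminf_positive M0 M1 \<phi> \<mu>0"
  obtains b where "0 < b" "\<And>\<mu> v S. \<mu> \<in> M1 \<Longrightarrow> 0 < v \<Longrightarrow> S \<in> C \<Longrightarrow> b \<le> E \<mu> (v *\<^sub>R S)"
proof -
  have "\<exists>b>0. \<forall>\<mu>\<in>M1. \<forall>v>0. \<forall>S\<in>C. b \<le> E \<mu> (v *\<^sub>R S)"
  proof (rule ccontr)
    assume "\<not> ?thesis"
    then have "\<exists>\<mu>\<in>M1. \<exists>v>0. \<exists>S\<in>C. \<not> b \<le> E \<mu> (v *\<^sub>R S)" if "0 < b" for b
      using that by blast
    then have "\<exists>\<mu> v S. \<mu> \<in> M1 \<and> 0 < v \<and> S \<in> C \<and> E \<mu> (v *\<^sub>R S) < 1 / Suc m" for m :: nat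
      unfolding not_le Bex_def by (metis of_nat_0_less_iff zero_less_Suc zero_less_divide_1_iff)
    then obtain \<mu> v S where S: "\<And>m. \<mu> m \<in> M1" "\<And>m. 0 < v m" "\<And>m. S m \<in> C"
      "\<And>m. E (\<mu> m) (v m *\<^sub>R S m) < 1 / Suc m" by metis
    obtain h s \<Phi> \<Psi> where *: "strict_mono (h :: nat \<Rightarrow> nat)" "\<And>i. (0::real) < s i" "\<And>i. sym_pos_def (\<Phi> i)"
      "\<Phi> \<longlonglongrightarrow> \<Psi>" "sym_pos_def \<Psi>"
      "\<And>i \<mu> v. 0 < v \<Longrightarrow> E \<mu> (v *\<^sub>R S (h i)) = E \<mu> ((v * s i) *\<^sub>R \<Phi> i)"
      "\<And>T. S \<longlonglongrightarrow> T \<Longrightarrow> det T = 0 \<Longrightarrow> s \<longlonglongrightarrow> 0"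
      by (rule model_subsequence[OF C bnd invJ reg meas S(3)]) (rule that)
    define \<nu> where "\<nu> i = (1 / sqrt (v (h i) * s i)) *\<^sub>R proj (\<mu> (h i) - \<mu>0)" for i
    have vs: "0 < v (h i) * s i" for i using S(2) *(2) by simp
    have E\<nu>: "E (\<mu> (h i)) (v (h i) *\<^sub>R S (h i)) = E (\<nu> i + \<mu>0) (\<Phi> i)" for i
      unfolding *(6)[OF S(2)] expectation_reduction[OF \<mu>0 vs *(3)] \<nu>_def ..
    have lim0: "(\<lambda>i. E (\<nu> i + \<mu>0) (\<Phi> i)) \<longlonglongrightarrow> 0"
    proof (rule tendsto_sandwich[OF _ _ tendsto_const])
      show "(\<lambda>i. 1 / real (Suc (h i))) \<longlonglongrightarrow> 0"
        using LIMSEQ_subseq_LIMSEQ[OF LIMSEQ_Suc[OF lim_1_over_n] *(1)] by (simp add: o_def)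
      show "\<forall>\<^sub>F i in sequentially. E (\<nu> i + \<mu>0) (\<Phi> i) \<le> 1 / real (Suc (h i))"
        using S(4) by (intro always_eventually allI) (simp only: E\<nu>[symmetric] less_imp_le)
      show "\<forall>\<^sub>F i in sequentially. 0 \<le> E (\<nu> i + \<mu>0) (\<Phi> i)"
        by (intro always_eventually allI gaussian_expectation_bounds meas range *(3))
    qed
    show False
    proof (cases "filterlim (\<lambda>i. norm (\<nu> i)) at_top sequentially")
      case True
      have "diverging_means M0 M1 \<mu>0 \<nu> \<Phi>"
        unfolding \<nu>_def
      proof (rule diverging_meansI[OF \<mu>0 S(1) _ _ *(3,4,5)])
        show "1 / sqrt (v (h i) * s i) \<noteq> 0" for i using vs[of i] by auto
        show "filterlim (\<lambda>i. norm ((1 / sqrt (v (h i) * s i)) *\<^sub>R proj (\<mu> (h i) - \<mu>0))) at_top sequentially"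
          using True unfolding \<nu>_def .
      qed
      then have "0 < liminf (\<lambda>i. ereal (E (\<nu> i + \<mu>0) (\<Phi> i)))"
        using pos by (simp add: liminf_positive_def)
      moreover have "(\<lambda>i. ereal (E (\<nu> i + \<mu>0) (\<Phi> i))) \<longlonglongrightarrow> 0"
        using lim0 by (simp only: zero_ereal_def lim_ereal)
      then have "liminf (\<lambda>i. ereal (E (\<nu> i + \<mu>0) (\<Phi> i))) = 0"
        by (rule lim_imp_Liminf[rotated]) simp
      ultimately show False by simp
    next
      case False
      then obtain k l where k: "strict_mono (k :: nat \<Rightarrow> nat)" "(\<lambda>i. \<nu> (k i)) \<longlonglongrightarrow> l"
        by (rule bounded_subsequence_or_diverges)
      have "(\<lambda>i. E (\<nu> (k i) + \<mu>0) (\<Phi> (k i))) \<longlonglongrightarrow> E (l + \<mu>0) \<Psi>"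
        using LIMSEQ_subseq_LIMSEQ[OF *(4) k(1)]
        by (intro gaussian_expectation_tendsto meas range tendsto_intros k(2) *(3,5)) (simp add: o_def)
      moreover have "(\<lambda>i. E (\<nu> (k i) + \<mu>0) (\<Phi> (k i))) \<longlonglongrightarrow> 0"
        using LIMSEQ_subseq_LIMSEQ[OF lim0 k(1)] by (simp add: o_def)
      ultimately have "E (l + \<mu>0) \<Psi> = 0" by (rule LIMSEQ_unique)
      then show False using gaussian_expectation_pos[OF *(5) meas range not0, of "l + \<mu>0"] by simp
    qed
  qed
  then show thesis using that by blast
qed

lemma null_expectation_positive:
  obtains b where "0 < b" "\<And>\<mu> v S. \<mu> \<in> M0 \<Longrightarrow> 0 < v \<Longrightarrow> S \<in> C \<Longrightarrow> b \<le> E \<mu> (v *\<^sub>R S)"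
proof -
  obtain \<mu>0 where \<mu>0: "\<mu>0 \<in> M0" using M0_ne by blast
  have "\<exists>b>0. \<forall>S\<in>C. b \<le> E \<mu>0 S"
  proof (rule ccontr)
    assume "\<not> ?thesis"
    then have "\<exists>S\<in>C. E \<mu>0 S < 1 / Suc m" for m :: nat
      by (simp add: not_le)
    then obtain S where S: "\<And>m. S m \<in> C" "\<And>m. E \<mu>0 (S m) < 1 / Suc m" by metis
    obtain h \<Psi> where h: "strict_mono (h :: nat \<Rightarrow> nat)" "sym_pos_def \<Psi>" "(\<lambda>i. E \<mu>0 (S (h i))) \<longlonglongrightarrow> E \<mu>0 \<Psi>"
      by (rule null_expectation_limit[of \<mu>0 S, OF \<mu>0 S(1)]) (rule that)
    have "(\<lambda>i. 1 / real (Suc (h i))) \<longlonglongrightarrow> 0"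
      using LIMSEQ_subseq_LIMSEQ[OF LIMSEQ_Suc[OF lim_1_over_n] h(1)] by (simp add: o_def)
    then have "E \<mu>0 \<Psi> \<le> 0"
      using S(2) by (intro LIMSEQ_le[OF h(3)]) (auto intro: less_imp_le)
    then show False using gaussian_expectation_pos[OF h(2) meas range not0, of \<mu>0] by simp
  qed
  then obtain b where "0 < b" "\<forall>S\<in>C. b \<le> E \<mu>0 S" by blast
  then show thesis using that[of b] expectation_null[OF \<mu>0] C_spd by simp
qed

text \<open>Here the distances relative to the scale are only bounded below by a constant, but the rescaled
  problem has variance \<open>v * s\<close> with \<open>s\<close> tending to zero: degeneration of the covariance matrix
  by itself drives the standardized deviation to infinity.\<close>

lemma power_tends_to_one_singular_limit:
  assumes \<mu>0: "\<mu>0 \<in> M0" and one: "liminf_one M0 M1 \<phi> \<mu>0" and c: "0 < c"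
    and S: "\<And>m. S m \<in> C" "S \<longlonglongrightarrow> T" "det T = 0"
  shows "(\<lambda>m. INF (\<mu>, v) \<in> {(\<mu>, v). \<mu> \<in> M1 \<and> 0 < v \<and> c \<le> infdist \<mu> M0 / sqrt v}. E \<mu> (v *\<^sub>R S m)) \<longlonglongrightarrow> 1"
proof (rule INF_tendsto_one)
  show "{(\<mu>, v). \<mu> \<in> M1 \<and> 0 < v \<and> c \<le> infdist \<mu> M0 / sqrt v} \<noteq> {}"
  proof -
    obtain \<mu> where "\<mu> \<in> M1" "c \<le> infdist \<mu> M0" using alternatives_ne by blast
    then have "(\<mu>, 1) \<in> {(\<mu>, v). \<mu> \<in> M1 \<and> 0 < v \<and> c \<le> infdist \<mu> M0 / sqrt v}" by simp
    then show ?thesis by blast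
  qed
  show "0 \<le> (case p of (\<mu>, v) \<Rightarrow> E \<mu> (v *\<^sub>R S m)) \<and> (case p of (\<mu>, v) \<Rightarrow> E \<mu> (v *\<^sub>R S m)) \<le> 1"
    if "p \<in> {(\<mu>, v). \<mu> \<in> M1 \<and> 0 < v \<and> c \<le> infdist \<mu> M0 / sqrt v}" for m p
    using that expectation_bounds[OF S(1)] by auto
next
  fix k :: "nat \<Rightarrow> nat" and p :: "nat \<Rightarrow> (real^'n) \<times> real"
  assume k: "strict_mono k" and p: "\<And>i. p i \<in> {(\<mu>, v). \<mu> \<in> M1 \<and> 0 < v \<and> c \<le> infdist \<mu> M0 / sqrt v}"
  define \<mu> where "\<mu> i = fst (p i)" for i
  define v where "v i = snd (p i)" for i
  have \<mu>v: "\<mu> i \<in> M1" "0 < v i" "c \<le> infdist (\<mu> i) M0 / sqrt (v i)" for i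
    using p[of i] by (auto simp: \<mu>_def v_def split: prod.splits)
  obtain h s \<Phi> \<Psi> where *: "strict_mono (h :: nat \<Rightarrow> nat)" "\<And>i. (0::real) < s i" "\<And>i. sym_pos_def (\<Phi> i)"
    "\<Phi> \<longlonglongrightarrow> \<Psi>" "sym_pos_def \<Psi>"
    "\<And>i \<mu> v. 0 < v \<Longrightarrow> E \<mu> (v *\<^sub>R S (k (h i))) = E \<mu> ((v * s i) *\<^sub>R \<Phi> i)"
    "\<And>T. (\<lambda>i. S (k i)) \<longlonglongrightarrow> T \<Longrightarrow> det T = 0 \<Longrightarrow> s \<longlonglongrightarrow> 0"
    by (rule model_subsequence[OF C bnd invJ reg meas, of "\<lambda>i. S (k i)", OF S(1)]) (rule that)
  have s0: "s \<longlonglongrightarrow> 0"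
    using LIMSEQ_subseq_LIMSEQ[OF S(2) k] S(3) by (intro *(7)) (auto simp: o_def)
  define \<nu> where "\<nu> i = (1 / sqrt (v (h i) * s i)) *\<^sub>R proj (\<mu> (h i) - \<mu>0)" for i
  have vs: "0 < v (h i) * s i" for i using \<mu>v(2) *(2) by simp
  have E\<nu>: "E (\<mu> (h i)) (v (h i) *\<^sub>R S (k (h i))) = E (\<nu> i + \<mu>0) (\<Phi> i)" for i
    unfolding *(6)[OF \<mu>v(2)] expectation_reduction[OF \<mu>0 vs *(3)] \<nu>_def ..
  have "diverging_means M0 M1 \<mu>0 \<nu> \<Phi>"
    unfolding \<nu>_def
  proof (rule diverging_meansI[OF \<mu>0 \<mu>v(1) _ _ *(3,4,5)])
    show "1 / sqrt (v (h i) * s i) \<noteq> 0" for i using vs[of i] by auto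
    have "(\<lambda>i. sqrt (s i) / c) \<longlonglongrightarrow> sqrt 0 / c"
      using c by (intro tendsto_intros s0) auto
    then have "filterlim (\<lambda>i. inverse (sqrt (s i) / c)) at_top sequentially"
      using *(2) c by (intro filterlim_inverse_at_top) auto
    then show "filterlim (\<lambda>i. norm ((1 / sqrt (v (h i) * s i)) *\<^sub>R proj (\<mu> (h i) - \<mu>0))) at_top sequentially"
    proof (rule filterlim_at_top_mono, intro always_eventually allI)
      fix i
      have "inverse (sqrt (s i) / c) = c / sqrt (s i)" by (simp add: field_simps)
      also have "\<dots> \<le> (norm (proj (\<mu> (h i) - \<mu>0)) / sqrt (v (h i))) / sqrt (s i)"
        using \<mu>v(3)[of "h i"] *(2)[of i] by (intro divide_right_mono) (auto simp: infdist_M0[OF \<mu>0])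
      also have "\<dots> = norm ((1 / sqrt (v (h i) * s i)) *\<^sub>R proj (\<mu> (h i) - \<mu>0))"
        using vs[of i] by (simp add: real_sqrt_mult abs_mult less_imp_le \<mu>v(2) *(2))
      finally show "inverse (sqrt (s i) / c) \<le> norm ((1 / sqrt (v (h i) * s i)) *\<^sub>R proj (\<mu> (h i) - \<mu>0))" .
    qed
  qed
  then have "(\<lambda>i. E (\<nu> i + \<mu>0) (\<Phi> i)) \<longlonglongrightarrow> 1" by (rule liminf_one_tendsto[OF one])
  then have "(\<lambda>i. case p (h i) of (\<mu>, v) \<Rightarrow> E \<mu> (v *\<^sub>R S (k (h i)))) \<longlonglongrightarrow> 1"
    by (simp only: E\<nu>[symmetric] \<mu>_def v_def case_prod_beta)
  then show "\<exists>h. strict_mono (h :: nat \<Rightarrow> nat) \<and> (\<lambda>i. case p (h i) of (\<mu>, v) \<Rightarrow> E \<mu> (v *\<^sub>R S (k (h i)))) \<longlonglongrightarrow> 1"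
    using *(1) by blast
qed

end

section \<open>The linear regression model\<close>

lemma null_means_translate:
  assumes "\<mu> \<in> null_means X R r"
  shows "(\<lambda>x. x - \<mu>) ` null_means X R r = (\<lambda>\<beta>. X *v \<beta>) ` {\<beta>. R *v \<beta> = 0}"
proof -
  obtain \<beta>0 where b0: "\<mu> = X *v \<beta>0" "R *v \<beta>0 = r" using assms by (auto simp: null_means_def)
  show ?thesis
  proof (intro equalityI subsetI)
    fix y assume "y \<in> (\<lambda>x. x - \<mu>) ` null_means X R r"
    then obtain \<beta> where "R *v \<beta> = r" "y = X *v \<beta> - \<mu>" by (auto simp: null_means_def)
    then have "y = X *v (\<beta> - \<beta>0)" "R *v (\<beta> - \<beta>0) = 0"
      using b0 by (simp_all add: matrix_vector_mult_diff_distrib)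
    then show "y \<in> (\<lambda>\<beta>. X *v \<beta>) ` {\<beta>. R *v \<beta> = 0}" by blast
  next
    fix y assume "y \<in> (\<lambda>\<beta>. X *v \<beta>) ` {\<beta>. R *v \<beta> = 0}"
    then obtain \<beta> where b: "R *v \<beta> = 0" "y = X *v \<beta>" by blast
    have "X *v (\<beta> + \<beta>0) \<in> null_means X R r"
      unfolding null_means_def using b(1) b0(2)
      by (intro CollectI exI[of _ "\<beta> + \<beta>0"]) (simp add: matrix_vector_right_distrib)
    moreover have "y = X *v (\<beta> + \<beta>0) - \<mu>"
      using b b0 by (simp add: matrix_vector_right_distrib)
    ultimately show "y \<in> (\<lambda>x. x - \<mu>) ` null_means X R r" by blast
  qed
qed

text \<open>Full column rank of \<open>X\<close> and full row rank of \<open>R\<close> guarantee that the null hypothesis is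
  nonempty and is not the whole column space of \<open>X\<close>.\<close>

lemma regression_testing_problem:
  fixes X :: "real^'k^'n" and R :: "real^'k^'q" and r :: "real^'q"
  assumes X: "rank X = CARD('k)" and R: "rank R = CARD('q)"
    and \<phi>: "\<phi> \<in> borel_measurable borel" "\<And>x. 0 \<le> \<phi> x \<and> \<phi> x \<le> 1"
      "almost_invariant (invariance_group (null_means X R r)) \<phi>"
      "\<not> (AE x in lborel. \<phi> x = 1)" "\<not> (AE x in lborel. \<phi> x = 0)"
  shows "invariant_testing_problem (span (columns X)) ((\<lambda>\<beta>. X *v \<beta>) ` {\<beta>. R *v \<beta> = 0}) (null_means X R r) \<phi>"
proof
  have injX: "inj ((*v) X)" using X full_rank_injective by blast
  have surjR: "surj ((*v) R)" using R full_rank_surjective by blast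
  obtain \<beta>0 where b0: "R *v \<beta>0 = r" using surjR by (metis surjD)
  then have "X *v \<beta>0 \<in> null_means X R r" by (auto simp: null_means_def)
  then show "null_means X R r \<noteq> {}" by blast
  have "r + axis undefined 1 \<noteq> r" by (simp add: axis_eq_0_iff)
  then obtain \<beta>1 where b1: "R *v \<beta>1 \<noteq> r" using surjR by (metis surjD)
  then have "X *v \<beta>1 \<notin> null_means X R r" using injX by (auto simp: null_means_def dest: injD)
  then show "span (columns X) - null_means X R r \<noteq> {}"
    using matrix_vector_mult_in_columnspace[of X \<beta>1] by blast
  show "null_means X R r \<subseteq> span (columns X)"
    using matrix_vector_mult_in_columnspace by (auto simp: null_means_def)
  have "subspace {\<beta>. R *v \<beta> = 0}"
    by (auto simp: subspace_def matrix_vector_right_distrib matrix_vector_mult_scaleR)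
  then show "subspace ((\<lambda>\<beta>. X *v \<beta>) ` {\<beta>. R *v \<beta> = 0})"
    by (intro linear_subspace_image matrix_vector_mul_linear)
qed (auto simp: null_means_translate \<phi>)

theorem theorem5p10:
  fixes X :: "real^'k^'n" and R :: "real^'k^'q" and r :: "real^'q"
    and C :: "(real^'n^'n) set" and \<phi> :: "real^'n \<Rightarrow> real"
  assumes "CARD('k) < CARD('n)"
    and "rank X = CARD('k)"
    and "rank R = CARD('q)"
    and "covariance_model C"
    and "\<phi> \<in> borel_measurable borel"
    and "\<And>x. 0 \<le> \<phi> x \<and> \<phi> x \<le> 1"
    and "almost_invariant (invariance_group (null_means X R r)) \<phi>"
    and "\<not> (AE x in lborel. \<phi> x = 1)"
    and "\<not> (AE x in lborel. \<phi> x = 0)"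
    and "bounded C"
  shows
    "((\<forall>x. \<forall>z\<in>concentration_set C. \<phi> (x + z) = \<phi> x) \<and> regular_rescaling C \<longrightarrow>
        \<comment> \<open>size below one, bounded away from zero\<close>
        (SUP \<mu>\<^sub>0\<in>null_means X R r. SUP v\<in>{0<..}. SUP S\<in>C. gaussian_expectation \<mu>\<^sub>0 (v *\<^sub>R S) \<phi>) < 1 \<and>
        (INF \<mu>\<^sub>0\<in>null_means X R r. INF v\<in>{0<..}. INF S\<in>C. gaussian_expectation \<mu>\<^sub>0 (v *\<^sub>R S) \<phi>) > 0 \<and>
        \<comment> \<open>infimal power positive\<close>
        (\<forall>\<mu>\<^sub>0\<in>null_means X R r. liminf_positive (null_means X R r) (alt_means X R r) \<phi> \<mu>\<^sub>0 \<longrightarrow>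
          (INF \<mu>\<^sub>1\<in>alt_means X R r. INF v\<in>{0<..}. INF S\<in>C. gaussian_expectation \<mu>\<^sub>1 (v *\<^sub>R S) \<phi>) > 0) \<and>
        \<comment> \<open>power tending to one: singular limit\<close>
        (\<forall>\<mu>\<^sub>0\<in>null_means X R r. liminf_one (null_means X R r) (alt_means X R r) \<phi> \<mu>\<^sub>0 \<longrightarrow>
          (\<forall>c>0. \<forall>S T. (\<forall>m. S m \<in> C) \<and> S \<longlonglongrightarrow> T \<and> det T = 0 \<longrightarrow>
            (\<lambda>m. INF (\<mu>\<^sub>1, v) \<in> {(\<mu>\<^sub>1, v). \<mu>\<^sub>1 \<in> alt_means X R r \<and> 0 < v \<and>
                                     c \<le> infdist \<mu>\<^sub>1 (null_means X R r) / sqrt v}.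
                   gaussian_expectation \<mu>\<^sub>1 (v *\<^sub>R S m) \<phi>) \<longlonglongrightarrow> 1))) \<and>
     \<comment> \<open>power tending to one: positive definite limit\<close>
     (\<forall>\<mu>\<^sub>0\<in>null_means X R r. liminf_one (null_means X R r) (alt_means X R r) \<phi> \<mu>\<^sub>0 \<longrightarrow>
        (\<forall>c v S T. (\<forall>m. 0 < c m) \<and> (\<forall>m. 0 < v m) \<and>
            filterlim (\<lambda>m. c m / sqrt (v m)) at_top sequentially \<and>
            (\<forall>m. S m \<in> C) \<and> S \<longlonglongrightarrow> T \<and> sym_pos_def T \<longrightarrow>
            (\<lambda>m. INF \<mu>\<^sub>1 \<in> {\<mu>\<^sub>1 \<in> alt_means X R r. c m \<le> infdist \<mu>\<^sub>1 (null_means X R r)}.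
                   gaussian_expectation \<mu>\<^sub>1 (v m *\<^sub>R S m) \<phi>) \<longlonglongrightarrow> 1)) \<and>
     \<comment> \<open>positivity of the limit inferior does not depend on the choice of the base point\<close>
     (\<forall>\<mu>\<^sub>0\<in>null_means X R r. \<forall>\<mu>\<^sub>0'\<in>null_means X R r.
        liminf_positive (null_means X R r) (alt_means X R r) \<phi> \<mu>\<^sub>0 \<longleftrightarrow>
        liminf_positive (null_means X R r) (alt_means X R r) \<phi> \<mu>\<^sub>0')"
proof -
  let ?M0 = "null_means X R r" and ?M1 = "alt_means X R r"
  interpret invariant_testing_problem "span (columns X)" "(\<lambda>\<beta>. X *v \<beta>) ` {\<beta>. R *v \<beta> = 0}" ?M0 \<phi>
    by (rule regression_testing_problem[OF assms(2,3,5-9)])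
  have spd: "sym_pos_def S" if "S \<in> C" for S using assms(4) that by (simp add: covariance_model_def)
  have M1: "?M1 = span (columns X) - ?M0" by (simp add: alt_means_def)
  have pos_ne: "{0<..} \<noteq> ({}::real set)" by (auto intro: exI[of _ 1])
  have base: "\<forall>\<mu>\<^sub>0\<in>?M0. \<forall>\<mu>\<^sub>0'\<in>?M0. liminf_positive ?M0 ?M1 \<phi> \<mu>\<^sub>0 \<longleftrightarrow> liminf_positive ?M0 ?M1 \<phi> \<mu>\<^sub>0'"
    unfolding M1 using liminf_positive_base_point by blast
  have regular: "\<forall>\<mu>\<^sub>0\<in>?M0. liminf_one ?M0 ?M1 \<phi> \<mu>\<^sub>0 \<longrightarrow>
        (\<forall>c v S T. (\<forall>m. 0 < c m) \<and> (\<forall>m. 0 < v m) \<and>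
            filterlim (\<lambda>m. c m / sqrt (v m)) at_top sequentially \<and>
            (\<forall>m. S m \<in> C) \<and> S \<longlonglongrightarrow> T \<and> sym_pos_def T \<longrightarrow>
            (\<lambda>m. INF \<mu>\<^sub>1 \<in> {\<mu>\<^sub>1 \<in> ?M1. c m \<le> infdist \<mu>\<^sub>1 ?M0}.
                   gaussian_expectation \<mu>\<^sub>1 (v m *\<^sub>R S m) \<phi>) \<longlonglongrightarrow> 1)"
    unfolding M1 by (intro ballI allI impI power_tends_to_one_regular_limit) (auto simp: spd)
  have concentrating:
    "(SUP \<mu>\<^sub>0\<in>?M0. SUP v\<in>{0<..}. SUP S\<in>C. gaussian_expectation \<mu>\<^sub>0 (v *\<^sub>R S) \<phi>) < 1 \<and>
     (INF \<mu>\<^sub>0\<in>?M0. INF v\<in>{0<..}. INF S\<in>C. gaussian_expectation \<mu>\<^sub>0 (v *\<^sub>R S) \<phi>) > 0 \<and>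
     (\<forall>\<mu>\<^sub>0\<in>?M0. liminf_positive ?M0 ?M1 \<phi> \<mu>\<^sub>0 \<longrightarrow>
        (INF \<mu>\<^sub>1\<in>?M1. INF v\<in>{0<..}. INF S\<in>C. gaussian_expectation \<mu>\<^sub>1 (v *\<^sub>R S) \<phi>) > 0) \<and>
     (\<forall>\<mu>\<^sub>0\<in>?M0. liminf_one ?M0 ?M1 \<phi> \<mu>\<^sub>0 \<longrightarrow>
        (\<forall>c>0. \<forall>S T. (\<forall>m. S m \<in> C) \<and> S \<longlonglongrightarrow> T \<and> det T = 0 \<longrightarrow>
          (\<lambda>m. INF (\<mu>\<^sub>1, v) \<in> {(\<mu>\<^sub>1, v). \<mu>\<^sub>1 \<in> ?M1 \<and> 0 < v \<and> c \<le> infdist \<mu>\<^sub>1 ?M0 / sqrt v}.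
                 gaussian_expectation \<mu>\<^sub>1 (v *\<^sub>R S m) \<phi>) \<longlonglongrightarrow> 1))"
    if ab: "(\<forall>x. \<forall>z\<in>concentration_set C. \<phi> (x + z) = \<phi> x) \<and> regular_rescaling C"
  proof -
    interpret concentrating_testing_problem "span (columns X)" "(\<lambda>\<beta>. X *v \<beta>) ` {\<beta>. R *v \<beta> = 0}" ?M0 \<phi> C
      using ab assms(4,10) by unfold_locales auto
    have size: "(SUP \<mu>\<^sub>0\<in>?M0. SUP v\<in>{0<..}. SUP S\<in>C. gaussian_expectation \<mu>\<^sub>0 (v *\<^sub>R S) \<phi>) < 1"
    proof -
      obtain b where b: "b < 1" "\<And>\<mu> v S. \<mu> \<in> ?M0 \<Longrightarrow> 0 < v \<Longrightarrow> S \<in> C \<Longrightarrow> gaussian_expectation \<mu> (v *\<^sub>R S) \<phi> \<le> b"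
        using size_less_one by blast
      have "(SUP \<mu>\<^sub>0\<in>?M0. SUP v\<in>{0<..}. SUP S\<in>C. gaussian_expectation \<mu>\<^sub>0 (v *\<^sub>R S) \<phi>) \<le> b"
        using b(2) by (intro cSUP_least M0_ne pos_ne C_ne) auto
      then show ?thesis using b(1) by simp
    qed
    have INF_pos: "(INF \<mu>\<in>M. INF v\<in>{0<..}. INF S\<in>C. gaussian_expectation \<mu> (v *\<^sub>R S) \<phi>) > 0"
      if "M \<noteq> {}" "0 < b" "\<And>\<mu> v S. \<mu> \<in> M \<Longrightarrow> 0 < v \<Longrightarrow> S \<in> C \<Longrightarrow> b \<le> gaussian_expectation \<mu> (v *\<^sub>R S) \<phi>"
      for M and b :: real
    proof -
      have "b \<le> (INF \<mu>\<in>M. INF v\<in>{0<..}. INF S\<in>C. gaussian_expectation \<mu> (v *\<^sub>R S) \<phi>)"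
        using that(1,3) by (intro cINF_greatest pos_ne C_ne) auto
      then show ?thesis using that(2) by simp
    qed
    have null: "(INF \<mu>\<^sub>0\<in>?M0. INF v\<in>{0<..}. INF S\<in>C. gaussian_expectation \<mu>\<^sub>0 (v *\<^sub>R S) \<phi>) > 0"
      by (rule null_expectation_positive) (rule INF_pos[OF M0_ne])
    have power: "(INF \<mu>\<^sub>1\<in>?M1. INF v\<in>{0<..}. INF S\<in>C. gaussian_expectation \<mu>\<^sub>1 (v *\<^sub>R S) \<phi>) > 0"
      if "\<mu>\<^sub>0 \<in> ?M0" "liminf_positive ?M0 ?M1 \<phi> \<mu>\<^sub>0" for \<mu>\<^sub>0
      using that unfolding M1 by (rule power_positive_from_liminf) (rule INF_pos[OF M1_ne])
    show ?thesis
      using size null power power_tends_to_one_singular_limit unfolding M1 by blast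
  qed
  show ?thesis
    using concentrating regular base by blast
qed

end
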